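(* (1) If there is infinite disorder, i.e. $\liminf_{n\to\infty}-\frac1n\log\mathbb P(\omega_1=+1,\ldots,\omega_n=+1)=0$, then $h_c(\beta)=-\beta$ for all $\beta>0$. (2) If there exists a constant $c>0$ such that for all $n\ge1$ and all indices $1\le i_1<i_2<\cdots<i_n$ one has $\mathbb P(\omega_{i_1}=+1,\ldots,\omega_{i_n}=+1)\le e^{-cn}$, then for every $\beta>0$ there exists a constant $c_\beta>0$, with $c_\beta$ uniformly bounded away from $0$ for $\beta\in(0,1)$, such that for all $\beta>0$ $$h_c(\beta)\ge-(1-c_\beta)\beta>-\beta .$$
   Context: Renewal process: $\tau=(\tau_i)_{i\ge 0}$ has law $\mathbf P$ (expectation $\mathbf E$), $\tau_0=0$, and the increments $(\tau_i-\tau_{i-1})_{i\ge1}$ are i.i.d. with values in $\mathbb N=\{1,2,\ldots\}$ and law $K(n):=\mathbf P(\tau_1=n)$. The renewal is recurrent, $\mathbf P(\tau_1=+\infty)=0$, and $K(n)=(1+o(1))\,c_K n^{-(1+\alpha)}$ as $n\to\infty$ for some $\alpha>0$, $\alpha\neq1$, and $c_K>0$. Set $\delta_n:=\mathbf 1_{\{n\in\{\tau_0,\tau_1,\ldots\}\}}$. Environment: $\omega=(\omega_i)_{i\ge0}$ is a stationary ergodic random sequence with values in $\{-1,+1\}$, with law $\mathbb P$ (independent of $\tau$), non-trivial in the sense that $\mathbb P(\omega_1=+1)>0$ and $\mathbb P(\omega_1=-1)>0$. Pinning model: for $h\in\mathbb R$, $\beta\ge0$, $Z_{N,h}^{\omega,\beta}:=\mathbf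 E\big[\exp\big(\sum_{n=1}^N(h+\beta\omega_n)\delta_n\big)\big]$. The quenched free energy $\mathtt F(\beta,h):=\lim_{N\to\infty}\frac1N\log Z_{N,h}^{\omega,\beta}$ exists and is $\mathbb P$-a.s. constant; $h\mapsto\mathtt F(\beta,h)$ is convex, non-negative and non-decreasing. The quenched critical point $h_c(\beta)$ is such that $\mathtt F(\beta,h)>0$ if and only if $h>h_c(\beta)$. *)

theory Defs
  imports "HOL-Probability.Probability" "HOL-Library.Landau_Symbols"
begin

text \<open>
  The renewal process and the environment live on two separate probability spaces \<open>M\<close> and \<open>Q\<close>.
  This encodes their independence: expectations over the renewal are taken with the realization
  of the environment held fixed.
\<close>

definition renewal_increment :: "(nat \<Rightarrow> 'a \<Rightarrow> nat) \<Rightarrow> nat \<Rightarrow> 'a \<Rightarrow> nat" where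
  "renewal_increment \<tau> i x = \<tau> (Suc i) x - \<tau> i x"

text \<open>
  The increments take values in \<open>{1, 2, \<dots>}\<close>, which is the clause \<open>\<tau> i x < \<tau> (Suc i) x\<close> (so the
  subtraction above never truncates). Recurrence, i.e. \<open>\<tau> 1 < \<infinity>\<close>, is encoded by the type \<^typ>\<open>nat\<close>.
\<close>

definition recurrent_renewal_process :: "'a measure \<Rightarrow> (nat \<Rightarrow> 'a \<Rightarrow> nat) \<Rightarrow> bool" where
  "recurrent_renewal_process M \<tau> \<longleftrightarrow>
     prob_space M \<and>
     (\<forall>i. \<tau> i \<in> measurable M (count_space UNIV)) \<and>
     (\<forall>x\<in>space M. \<tau> 0 x = 0 \<and> (\<forall>i. \<tau> i x < \<tau> (Suc i) x)) \<and>
     prob_space.indep_vars M (\<lambda>_. count_space UNIV) (renewal_increment \<tau>) UNIV \<and>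
     (\<forall>i. distr M (count_space UNIV) (renewal_increment \<tau> i) =
          distr M (count_space UNIV) (renewal_increment \<tau> 0))"

definition renewal_kernel :: "'a measure \<Rightarrow> (nat \<Rightarrow> 'a \<Rightarrow> nat) \<Rightarrow> nat \<Rightarrow> real" where
  "renewal_kernel M \<tau> n = measure M {x \<in> space M. \<tau> 1 x = n}"

definition renewal_indicator :: "(nat \<Rightarrow> 'a \<Rightarrow> nat) \<Rightarrow> nat \<Rightarrow> 'a \<Rightarrow> real" where
  "renewal_indicator \<tau> n x = of_bool (n \<in> range (\<lambda>i. \<tau> i x))"

definition random_sequence :: "'b measure \<Rightarrow> 'c measure \<Rightarrow> (nat \<Rightarrow> 'b \<Rightarrow> 'c) \<Rightarrow> bool" where
  "random_sequence Q S X \<longleftrightarrow> prob_space Q \<and> (\<forall>i. X i \<in> measurable Q S)"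

definition sequence_law :: "'b measure \<Rightarrow> 'c measure \<Rightarrow> (nat \<Rightarrow> 'b \<Rightarrow> 'c) \<Rightarrow> (nat \<Rightarrow> 'c) measure" where
  "sequence_law Q S X = distr Q (PiM UNIV (\<lambda>_. S)) (\<lambda>x i. X i x)"

definition stationary :: "'b measure \<Rightarrow> 'c measure \<Rightarrow> (nat \<Rightarrow> 'b \<Rightarrow> 'c) \<Rightarrow> bool" where
  "stationary Q S X \<longleftrightarrow> sequence_law Q S (\<lambda>i. X (Suc i)) = sequence_law Q S X"

definition shift_invariant_sets :: "'c measure \<Rightarrow> (nat \<Rightarrow> 'c) set set" where
  "shift_invariant_sets S =
     {A \<in> sets (PiM UNIV (\<lambda>_. S)). {w \<in> space (PiM UNIV (\<lambda>_. S)). (\<lambda>i. w (Suc i)) \<in> A} = A}"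

definition ergodic :: "'b measure \<Rightarrow> 'c measure \<Rightarrow> (nat \<Rightarrow> 'b \<Rightarrow> 'c) \<Rightarrow> bool" where
  "ergodic Q S X \<longleftrightarrow> (\<forall>A\<in>shift_invariant_sets S. measure (sequence_law Q S X) A \<in> {0, 1})"

definition pinning_environment :: "'b measure \<Rightarrow> (nat \<Rightarrow> 'b \<Rightarrow> real) \<Rightarrow> bool" where
  "pinning_environment Q \<omega> \<longleftrightarrow>
     random_sequence Q (count_space {-1, 1}) \<omega> \<and>
     stationary Q (count_space {-1, 1}) \<omega> \<and>
     ergodic Q (count_space {-1, 1}) \<omega> \<and>
     measure Q {y \<in> space Q. \<omega> 1 y = 1} > 0 \<and>
     measure Q {y \<in> space Q. \<omega> 1 y = -1} > 0"

definition pinning_partition_function ::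
    "'a measure \<Rightarrow> (nat \<Rightarrow> 'a \<Rightarrow> nat) \<Rightarrow> (nat \<Rightarrow> real) \<Rightarrow> real \<Rightarrow> real \<Rightarrow> nat \<Rightarrow> real" where
  "pinning_partition_function M \<tau> w \<beta> h N =
     (\<integral>x. exp (\<Sum>n=1..N. (h + \<beta> * w n) * renewal_indicator \<tau> n x) \<partial>M)"

definition quenched_free_energy ::
    "'a measure \<Rightarrow> (nat \<Rightarrow> 'a \<Rightarrow> nat) \<Rightarrow> 'b measure \<Rightarrow> (nat \<Rightarrow> 'b \<Rightarrow> real) \<Rightarrow> real \<Rightarrow> real \<Rightarrow> real" where
  "quenched_free_energy M \<tau> Q \<omega> \<beta> h =
     (THE f. AE y in Q.
        (\<lambda>N. 1 / real N * ln (pinning_partition_function M \<tau> (\<lambda>i. \<omega> i y) \<beta> h N)) \<longlonglongrightarrow> f)"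

definition quenched_critical_point ::
    "'a measure \<Rightarrow> (nat \<Rightarrow> 'a \<Rightarrow> nat) \<Rightarrow> 'b measure \<Rightarrow> (nat \<Rightarrow> 'b \<Rightarrow> real) \<Rightarrow> real \<Rightarrow> real" where
  "quenched_critical_point M \<tau> Q \<omega> \<beta> =
     (THE h\<^sub>c. \<forall>h. quenched_free_energy M \<tau> Q \<omega> \<beta> h > 0 \<longleftrightarrow> h > h\<^sub>c)"

text \<open>
  \<open>- log p\<close> with the convention \<open>- log 0 = \<infinity>\<close>; the real logarithm of HOL has \<open>ln 0 = 0\<close>, which
  would wrongly make an environment without long runs of \<open>+1\<close> satisfy the condition below.
\<close>

definition neg_log :: "real \<Rightarrow> ereal" where
  "neg_log p = (if p = 0 then \<infinity> else ereal (- ln p))"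

definition infinite_disorder :: "'b measure \<Rightarrow> (nat \<Rightarrow> 'b \<Rightarrow> real) \<Rightarrow> bool" where
  "infinite_disorder Q \<omega> \<longleftrightarrow>
     liminf (\<lambda>n. ereal (1 / real n) * neg_log (measure Q {y \<in> space Q. \<forall>i\<in>{1..n}. \<omega> i y = 1})) = 0"

end

theory Submission
  imports Defs "HOL-Real_Asymp.Real_Asymp"
begin

text \<open>
  Write \<open>Z\<^sub>N(w)\<close> for the partition function in the environment \<open>w\<close> and \<open>\<theta>\<close> for the shift. The
  critical point is a definite description built on another one, the free energy
  \<open>F = lim (1 / N) log Z\<^sub>N\<close>. Hence neither bound on it makes sense before the limit is known to
  exist almost surely and to be a constant, and before \<open>{h. F > 0}\<close> is known to be an open
  half-line.

  \<^emph>\<open>Existence of the free energy.\<close> The polynomial tail of the kernel makes \<open>log Z\<close> additive up to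
  small errors, so the additive ergodic theorem suffices (it is derived here from the maximal
  inequality, \<open>birkhoff\<close>). Let \<open>X\<^sub>m\<close> be one plus the sum over \<open>b \<le> m\<close> of the partition functions of
  the window \<open>{1..m}\<close> for a renewal whose first point is \<open>b\<close>. The renewal property gives
  \<open>Z\<^sub>N\<^sub>+\<^sub>m \<le> Z\<^sub>N X\<^sub>m(\<theta>\<^sup>N w)\<close> (\<open>free_add_le\<close>). For the reverse direction the probability of the
  last, incomplete jump is replaced by a weight \<open>exp(- l \<cdot> length)\<close>. Because a jump over \<open>n\<close> sites
  has probability at least \<open>c exp(- l n)\<close> for every \<open>l > 0\<close>, prolonging the incomplete jump to any
  site of the next window costs only the factor \<open>c exp(- l m)\<close>, up to constants
  (\<open>discounted_add_ge\<close>). Both inequalities are summed over all \<open>N\<close>, the sum of the increments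
  telescopes, and the ergodic theorem evaluates the rest: \<open>F\<close> is the infimum of
  \<open>E (log X\<^sub>m) / m\<close> (\<open>growth_rate_exists\<close>). The lower inequality also yields the explicit bound
  \<open>free_energy_ge_log_entry\<close>. The free energy is non-decreasing and 1-Lipschitz in \<open>h\<close>, at most \<open>0\<close>
  for \<open>h \<le> - \<beta>\<close> and positive for large \<open>h\<close>, which gives \<open>critical_point_iff\<close>.

  \<^emph>\<open>Infinite disorder.\<close> Let \<open>d = h + \<beta> > 0\<close>. A recurrent renewal rewarded by \<open>d\<close> at each visit gains
  a factor \<open>exp(\<kappa> m)\<close> on a window of \<open>m\<close> sites, with \<open>\<kappa> > 0\<close>
  (\<open>free_homogeneous_growth\<close>). Visit only the windows filled with \<open>+1\<close>. Their density is a
  number \<open>p\<close> with \<open>p \<ge> exp(- \<epsilon> m)\<close>, so that typical gaps have length \<open>1 / p\<close> and a jump costs a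
  power of \<open>p\<close>, that is \<open>exp(- C \<epsilon> m)\<close> at worst, which is beaten by the gain when
  \<open>\<epsilon>\<close> is small. Gaps may be very irregular in a general ergodic environment; the tangent
  \<open>log n \<le> log D + n / D - 1\<close> of the logarithm with \<open>D = A / p\<close> replaces their logarithmic costs by
  linear ones, whose total is controlled (\<open>free_energy_pos_of_infinite_disorder\<close>).

  \<^emph>\<open>Exponentially rare favourable sites.\<close> With \<open>q = exp(- 2 \<beta>)\<close> a visited site contributes
  \<open>exp(h + \<beta>) (q + (1 - q) 1[w\<^sub>n = 1])\<close>. Expanding the product over the visited set \<open>S\<close> and applying
  the hypothesis to each subset bounds the average over the environment by
  \<open>(exp(h + \<beta>) (q + (1 - q) exp(- c)))\<close> to the power of the size of \<open>S\<close>. For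
  \<open>h + \<beta> = (1 - q) (1 - exp(- c))\<close> the base is at most \<open>1\<close>, so \<open>E Z\<^sub>N \<le> 1\<close> and the free energy
  vanishes there (\<open>critical_point_ge\<close>).
\<close>

section \<open>An ergodic theorem\<close>

locale ergodic_transformation = prob_space P for P :: "'w measure" +
  fixes T :: "'w \<Rightarrow> 'w"
  assumes T_measurable [measurable]: "T \<in> measurable P P"
    and T_preserving: "distr P P T = P"
    and T_ergodic: "A \<in> sets P \<Longrightarrow> T -` A \<inter> space P = A \<Longrightarrow> prob A \<in> {0, 1}"
begin

text \<open>
  \<open>peak f n w\<close> is the maximum of the Birkhoff sums of \<open>f\<close> of lengths \<open>0, \<dots>, n\<close> at \<open>w\<close>: a nonempty
  sum is \<open>f w\<close> plus a shorter sum started at \<open>T w\<close>.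
\<close>

fun peak :: "('w \<Rightarrow> real) \<Rightarrow> nat \<Rightarrow> 'w \<Rightarrow> real" where
  "peak f 0 w = 0"
| "peak f (Suc n) w = max 0 (f w + peak f n (T w))"

lemma integral_comp_T:
  fixes g :: "'w \<Rightarrow> real"
  assumes [measurable]: "g \<in> borel_measurable P"
  shows "(\<integral>w. g (T w) \<partial>P) = (\<integral>w. g w \<partial>P)"
  using integral_distr[of T P P g] by (simp add: T_preserving)

lemma peak_measurable [measurable]:
  fixes f :: "'w \<Rightarrow> real"
  assumes [measurable]: "f \<in> borel_measurable P"
  shows "peak f n \<in> borel_measurable P"
  by (induction n) (simp_all add: peak.simps[abs_def])

lemma peak_nonneg: "0 \<le> peak f n w"
  by (cases n) auto

lemma peak_mono_Suc: "peak f n w \<le> peak f (Suc n) w"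
proof (induction n arbitrary: w)
  case (Suc n)
  then show ?case by (simp only: peak.simps) (meson add_left_mono max.mono order_refl)
qed auto

lemma peak_mono: "m \<le> n \<Longrightarrow> peak f m w \<le> peak f n w"
  using lift_Suc_mono_le[of "\<lambda>n. peak f n w"] peak_mono_Suc by blast

lemma peak_bounded:
  assumes "\<And>w. w \<in> space P \<Longrightarrow> \<bar>f w\<bar> \<le> B" "w \<in> space P"
  shows "\<bar>peak f n w\<bar> \<le> real n * B"
  using assms(2)
proof (induction n arbitrary: w)
  case (Suc n)
  have "T w \<in> space P" using Suc.prems measurable_space[OF T_measurable] by blast
  then have "\<bar>peak f n (T w)\<bar> \<le> real n * B" by (rule Suc.IH)
  moreover have "\<bar>f w\<bar> \<le> B" using assms(1) Suc.prems by blast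
  ultimately show ?case by (simp add: algebra_simps) 
qed auto

lemma birkhoff_sum_le_peak: "(\<Sum>k<n. f ((T ^^ k) w)) \<le> peak f n w"
proof (induction n arbitrary: w)
  case (Suc n)
  have "(\<Sum>k<Suc n. f ((T ^^ k) w)) = f w + (\<Sum>k<n. f ((T ^^ k) (T w)))"
    by (subst sum.lessThan_Suc_shift) (simp add: funpow_swap1)
  then show ?case using Suc.IH[of "T w"] by simp
qed auto

text \<open>
  The maximal inequality. Where \<open>peak f n\<close> is positive, the recursion and monotonicity in \<open>n\<close> give
  \<open>f \<ge> peak f n - peak f n \<circ> T\<close>; elsewhere the right-hand side is at most \<open>0\<close>. It has integral
  \<open>0\<close> because \<open>T\<close> preserves the measure, and the set exhausts the space as \<open>n\<close> grows.
\<close>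

lemma integral_nonneg_of_peak_pos:
  fixes f :: "'w \<Rightarrow> real"
  assumes [measurable]: "f \<in> borel_measurable P"
    and B: "\<And>w. w \<in> space P \<Longrightarrow> \<bar>f w\<bar> \<le> B"
    and pos: "AE w in P. \<exists>n. peak f n w > 0"
  shows "0 \<le> (\<integral>w. f w \<partial>P)"
proof -
  have B0: "0 \<le> B" using B not_empty abs_ge_zero order_trans by blast
  define g where "g n w = f w * indicator {w. peak f n w > 0} w" for n w
  have [measurable]: "g n \<in> borel_measurable P" for n unfolding g_def by measurable
  have int_peak: "integrable P (peak f n)" for n
    by (rule integrable_const_bound[where B="real n * B"]) (auto simp: peak_bounded[OF B])
  have int_g: "integrable P (g n)" for n
    by (rule integrable_const_bound[where B="B"])
      (auto simp: g_def indicator_def B0 B)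
  have ge: "0 \<le> (\<integral>w. g n w \<partial>P)" for n
  proof -
    have int_T: "integrable P (\<lambda>w. peak f n (T w))"
      using integrable_distr_eq[of T P P "peak f n"] int_peak by (simp add: T_preserving)
    have "peak f n w - peak f n (T w) \<le> g n w" for w
    proof (cases n)
      case 0 then show ?thesis by (simp add: g_def)
    next
      case (Suc m)
      show ?thesis
      proof (cases "peak f n w > 0")
        case True
        then show ?thesis using Suc peak_mono_Suc[of f m "T w"] 
          by (auto simp: g_def max_def split: if_splits)
      next
        case False
        then show ?thesis using peak_nonneg[of f n "T w"] by (simp add: g_def)
      qed
    qed
    then have "(\<integral>w. peak f n w - peak f n (T w) \<partial>P) \<le> (\<integral>w. g n w \<partial>P)"
      by (intro integral_mono int_g Bochner_Integration.integrable_diff int_peak int_T)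
    then show ?thesis
      using int_peak int_T by (simp add: integral_comp_T)
  qed
  have "(\<lambda>n. \<integral>w. g n w \<partial>P) \<longlonglongrightarrow> (\<integral>w. f w \<partial>P)"
  proof (rule integral_dominated_convergence[where w="\<lambda>_. B"])
    show "AE w in P. (\<lambda>n. g n w) \<longlonglongrightarrow> f w"
      using pos
    proof eventually_elim
      case (elim w)
      then obtain m where "peak f m w > 0" by blast
      then have "peak f n w > 0" if "n \<ge> m" for n
        using peak_mono[OF that, of f w] by simp
      then have "\<forall>\<^sub>F n in sequentially. g n w = f w"
        unfolding eventually_sequentially by (intro exI[of _ m]) (simp add: g_def)
      then show ?case by (rule tendsto_eventually)
    qed
  qed (auto simp: g_def indicator_def B0 B)
  then show ?thesis using ge by (intro LIMSEQ_le_const) auto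
qed

text \<open>
  The set where the Birkhoff sums are unbounded above is exactly invariant, because moving the
  starting point changes them by a bounded amount. So it has probability \<open>0\<close> or \<open>1\<close>, and the maximal
  inequality rules out \<open>1\<close> when the mean is negative.
\<close>

lemma birkhoff_sum_bounded_above:
  fixes f :: "'w \<Rightarrow> real"
  assumes [measurable]: "f \<in> borel_measurable P"
    and B: "\<And>w. w \<in> space P \<Longrightarrow> \<bar>f w\<bar> \<le> B"
    and neg: "(\<integral>w. f w \<partial>P) < 0"
  shows "AE w in P. \<exists>C. \<forall>n. (\<Sum>k<n. f ((T ^^ k) w)) \<le> C"
proof -
  let ?S = "\<lambda>n (w::'w). \<Sum>k<n. f ((T ^^ k) w)"
  define A where "A = {w \<in> space P. \<forall>C::nat. \<exists>n. ?S n w > real C}"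
  have Tk[measurable]: "T ^^ k \<in> measurable P P" for k
    by (induction k) (auto simp: measurable_compose)
  have [measurable]: "?S n \<in> borel_measurable P" for n by measurable
  have A[measurable]: "A \<in> sets P" unfolding A_def by measurable
  have Sn: "?S (Suc n) w = f w + ?S n (T w)" for n w
    by (subst sum.lessThan_Suc_shift) (simp add: funpow_swap1)
  have "T w \<in> A \<longleftrightarrow> w \<in> A" if w: "w \<in> space P" for w
  proof
    have Tw: "T w \<in> space P" using w measurable_space[OF T_measurable] by blast
    obtain m :: nat where m: "B \<le> m" using real_arch_simple by blast
    have f: "\<bar>f w\<bar> \<le> m" using B[OF w] m by simp
    show "w \<in> A" if TA: "T w \<in> A"
      unfolding A_def
    proof (safe intro!: w)
      fix C :: nat
      obtain n where "?S n (T w) > real (C + m)" using TA unfolding A_def by blast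
      then have "?S (Suc n) w > C" unfolding Sn using f by simp
      then show "\<exists>n. ?S n w > real C" by blast
    qed
    show "T w \<in> A" if TA: "w \<in> A"
      unfolding A_def
    proof (safe intro!: Tw)
      fix C :: nat
      obtain n where n: "?S n w > real (C + m)" using TA unfolding A_def by blast
      then obtain n' where n': "n = Suc n'" by (cases n) auto
      have "?S n' (T w) > C" using n f unfolding n' Sn by simp
      then show "\<exists>n. ?S n (T w) > real C" by blast
    qed
  qed
  then have "T -` A \<inter> space P = A" using sets.sets_into_space[OF A] by blast
  then have "prob A \<in> {0, 1}" using T_ergodic[OF A] by blast
  moreover have "prob A \<noteq> 1"
  proof
    assume "prob A = 1"
    then have "AE w in P. w \<in> A" using prob_eq_1[OF A] by blast
    then have "AE w in P. \<exists>n. peak f n w > 0"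
    proof eventually_elim
      case (elim w)
      then obtain n where "?S n w > real 0" unfolding A_def by blast
      then show ?case using birkhoff_sum_le_peak[of f w n] by (intro exI[of _ n]) simp
    qed
    then show False using integral_nonneg_of_peak_pos[of f B] B neg by simp
  qed
  ultimately have "prob A = 0" by blast
  then have "AE w in P. w \<notin> A" using prob_eq_0[OF A] by blast
  then show ?thesis
    using AE_space
  proof eventually_elim
    case (elim w)
    then obtain C :: nat where "\<not> (\<exists>n. ?S n w > real C)" unfolding A_def by blast
    then show ?case by (intro exI[of _ "real C"]) (simp add: not_less)
  qed
qed

text \<open>
  Subtracting a constant slightly larger than the mean makes the mean negative, and bounded sums do
  not contribute to the averages.
\<close>

lemma birkhoff_limsup_le:
  fixes f :: "'w \<Rightarrow> real"
  assumes [measurable]: "f \<in> borel_measurable P"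
    and B: "\<And>w. w \<in> space P \<Longrightarrow> \<bar>f w\<bar> \<le> B"
  shows "AE w in P. \<forall>e>0. \<forall>\<^sub>F n in sequentially.
           (\<Sum>k<n. f ((T ^^ k) w)) / real n \<le> (\<integral>w. f w \<partial>P) + e"
proof -
  have int: "integrable P f" by (rule integrable_const_bound[where B=B]) (auto simp: B)
  let ?a = "\<lambda>j::nat. (\<integral>w. f w \<partial>P) + 1 / real (Suc j)"
  have "AE w in P. \<forall>j. \<exists>C. \<forall>n. (\<Sum>k<n. f ((T ^^ k) w) - ?a j) \<le> C"
  proof (subst AE_all_countable, rule)
    fix j
    show "AE w in P. \<exists>C. \<forall>n. (\<Sum>k<n. f ((T ^^ k) w) - ?a j) \<le> C"
    proof (rule birkhoff_sum_bounded_above[where B="B + \<bar>?a j\<bar>"])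
      show "\<bar>f w - ?a j\<bar> \<le> B + \<bar>?a j\<bar>" if "w \<in> space P" for w
        using B[OF that] by linarith
      show "(\<integral>w. f w - ?a j \<partial>P) < 0"
        using int by (simp add: prob_space)
    qed auto
  qed
  then show ?thesis
  proof eventually_elim
    case (elim w)
    show ?case
    proof (intro allI impI)
      fix e :: real assume "e > 0"
      then obtain j where j: "1 / real (Suc j) < e / 2"
        using reals_Archimedean[of "e/2"] by (auto simp: inverse_eq_divide)
      obtain C where C: "(\<Sum>k<n. f ((T ^^ k) w) - ?a j) \<le> C" for n using elim by blast
      have "(\<lambda>n. C / real n) \<longlonglongrightarrow> 0" by real_asymp
      then have "\<forall>\<^sub>F n in sequentially. C / real n < e / 2"
        using \<open>e > 0\<close> by (intro order_tendstoD) auto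
      then show "\<forall>\<^sub>F n in sequentially. (\<Sum>k<n. f ((T ^^ k) w)) / real n \<le> (\<integral>w. f w \<partial>P) + e"
        using eventually_gt_at_top[of 0]
      proof eventually_elim
        case (elim n)
        have "(\<Sum>k<n. f ((T ^^ k) w)) \<le> C + real n * ?a j" using C[of n]
          by (simp add: sum_subtractf)
        then have "(\<Sum>k<n. f ((T ^^ k) w)) / real n \<le> C / real n + ?a j"
          using elim(2) by (subst pos_divide_le_eq) (simp_all add: distrib_left mult.commute[of _ "real n"])
        then show ?case using elim(1) j by (simp only: add.commute)
      qed
    qed
  qed
qed

theorem birkhoff:
  fixes f :: "'w \<Rightarrow> real"
  assumes [measurable]: "f \<in> borel_measurable P"
    and B: "\<And>w. w \<in> space P \<Longrightarrow> \<bar>f w\<bar> \<le> B"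
  shows "AE w in P. (\<lambda>n. (\<Sum>k<n. f ((T ^^ k) w)) / real n) \<longlonglongrightarrow> (\<integral>w. f w \<partial>P)"
proof -
  have "AE w in P. \<forall>e>0. \<forall>\<^sub>F n in sequentially.
           (\<Sum>k<n. - f ((T ^^ k) w)) / real n \<le> (\<integral>w. - f w \<partial>P) + e"
    by (rule birkhoff_limsup_le[where B=B]) (auto simp: B)
  then show ?thesis
    using birkhoff_limsup_le[OF assms(1) B, simplified]
  proof eventually_elim
    case (elim w)
    show ?case
    proof (rule LIMSEQ_I)
      fix r :: real assume "r > 0"
      then have "\<forall>\<^sub>F n in sequentially. (\<Sum>k<n. - f ((T ^^ k) w)) / real n \<le> (\<integral>w. - f w \<partial>P) + r/2"
        "\<forall>\<^sub>F n in sequentially. (\<Sum>k<n. f ((T ^^ k) w)) / real n \<le> (\<integral>w. f w \<partial>P) + r/2"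
        using elim by simp_all
      then have "\<forall>\<^sub>F n in sequentially. norm ((\<Sum>k<n. f ((T ^^ k) w)) / real n - (\<integral>w. f w \<partial>P)) < r"
      proof eventually_elim
        case (elim n)
        then show ?case using \<open>r > 0\<close> by (auto simp: sum_negf abs_less_iff)
      qed
      then show "\<exists>no. \<forall>n\<ge>no. norm ((\<Sum>k<n. f ((T ^^ k) w)) / real n - (\<integral>w. f w \<partial>P)) < r"
        by (simp add: eventually_sequentially)
    qed
  qed
qed

end

section \<open>Partition functions of a renewal kernel\<close>

text \<open>
  \<open>shifted b v\<close> is what \<open>v\<close> looks like from the site \<open>b\<close>. Site \<open>0\<close> is the starting point of the renewal
  and carries no weight, so the first weighted site after \<open>b\<close> is \<open>shifted b v 1\<close>.
\<close>

definition shifted :: "nat \<Rightarrow> (nat \<Rightarrow> 'c) \<Rightarrow> nat \<Rightarrow> 'c" where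
  "shifted b v = (\<lambda>n. v (b + n))"

lemma shifted_apply [simp]: "shifted b v n = v (b + n)"
  by (simp add: shifted_def)

lemma shifted_shifted: "shifted a (shifted b v) = shifted (b + a) v"
  by (simp add: shifted_def add.assoc)

lemma sum_triangle_swap:
  fixes f :: "nat \<Rightarrow> nat \<Rightarrow> real"
  shows "(\<Sum>a=1..m. \<Sum>b=1..a. f a b) = (\<Sum>b=1..m. \<Sum>a=b..m. f a b)"
  by (induction m) (simp_all add: sum.distrib)

locale renewal_law =
  fixes K :: "nat \<Rightarrow> real"
  assumes K_nonneg: "0 \<le> K n"
    and K_0: "K 0 = 0"
    and K_sums: "K sums 1"
begin

definition tail :: "nat \<Rightarrow> real" where
  "tail n = 1 - (\<Sum>k\<le>n. K k)"

text \<open>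
  The partition function of \<open>{1..n}\<close> restricted to paths that renew at \<open>n\<close>, in a potential \<open>v\<close>,
  obtained by summing over the previous renewal point.
\<close>

fun pinned :: "(nat \<Rightarrow> real) \<Rightarrow> nat \<Rightarrow> real" where
  "pinned v n = (if n = 0 then 1 else exp (v n) * (\<Sum>a<n. pinned v a * K (n - a)))"

declare pinned.simps [simp del]

text \<open>
  The unrestricted partition function of \<open>{1..N}\<close>: \<open>a\<close> is the last renewal point up to \<open>N\<close>.
\<close>

definition free :: "(nat \<Rightarrow> real) \<Rightarrow> nat \<Rightarrow> real" where
  "free v N = (\<Sum>a\<le>N. pinned v a * tail (N - a))"

text \<open>
  The contributions to a window \<open>{1..M}\<close> when a renewal enters it at \<open>b\<close>, without the probability of the
  entering jump. It is a sum over \<open>b\<close> and not a maximum because the comparisons of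
  \<open>free (N + M)\<close> with \<open>free N\<close> hold for all entry points simultaneously.
\<close>

definition entry_sum :: "(nat \<Rightarrow> real) \<Rightarrow> nat \<Rightarrow> real" where
  "entry_sum v M = (\<Sum>b=1..M. exp (v b) * free (shifted b v) (M - b))"

subsection \<open>Elementary bounds\<close>

lemma pinned_0 [simp]: "pinned v 0 = 1"
  by (simp add: pinned.simps)

lemma pinned_pos_index: "n > 0 \<Longrightarrow> pinned v n = exp (v n) * (\<Sum>a<n. pinned v a * K (n - a))"
  by (simp add: pinned.simps)

lemma sum_K_le_1: "finite A \<Longrightarrow> (\<Sum>k\<in>A. K k) \<le> 1"
  using sum_le_suminf[of K A] K_sums K_nonneg by (simp add: sums_iff)

lemma tail_nonneg: "0 \<le> tail n"
  unfolding tail_def using sum_K_le_1[of "{..n}"] by simp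

lemma tail_le_1: "tail n \<le> 1"
  unfolding tail_def using K_nonneg by (simp add: sum_nonneg)

lemma tail_0 [simp]: "tail 0 = 1"
  by (simp add: tail_def K_0)

lemma tail_Suc: "tail (Suc n) = tail n - K (Suc n)"
  by (simp add: tail_def)

lemma tail_antimono: "m \<le> n \<Longrightarrow> tail n \<le> tail m"
  unfolding tail_def using K_nonneg by (auto intro!: sum_mono2)

lemma K_le_tail: "n < m \<Longrightarrow> K m \<le> tail n"
  using sum_K_le_1[of "insert m {..n}"] by (simp add: tail_def)

lemma pinned_nonneg: "0 \<le> pinned v n"
proof (induction n rule: less_induct)
  case (less n)
  then show ?case by (subst pinned.simps) (auto intro!: mult_nonneg_nonneg sum_nonneg K_nonneg)
qed

lemma pinned_mono:
  assumes "\<And>i. 1 \<le> i \<Longrightarrow> i \<le> n \<Longrightarrow> v i \<le> u i"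
  shows "pinned v n \<le> pinned u n"
  using assms
proof (induction n rule: less_induct)
  case (less n)
  have "pinned v a \<le> pinned u a" if "a < n" for a
    using that less.prems by (intro less.IH) auto
  then show ?case using less.prems 
    by (subst (1 2) pinned.simps)
      (auto intro!: mult_mono sum_mono mult_right_mono sum_nonneg mult_nonneg_nonneg K_nonneg pinned_nonneg)
qed

lemma free_mono: "(\<And>i. 1 \<le> i \<Longrightarrow> i \<le> N \<Longrightarrow> v i \<le> u i) \<Longrightarrow> free v N \<le> free u N"
  unfolding free_def by (intro sum_mono mult_right_mono pinned_mono tail_nonneg) auto

lemma pinned_add_const_le:
  assumes "d \<ge> 0"
  shows "pinned (\<lambda>i. v i + d) n \<le> exp (d * real n) * pinned v n"
proof (induction n rule: less_induct)
  case (less n)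
  show ?case
  proof (cases "n = 0")
    case False
    have "(\<Sum>a<n. pinned (\<lambda>i. v i + d) a * K (n - a)) \<le> (\<Sum>a<n. exp (d * real (n - 1)) * (pinned v a * K (n - a)))"
    proof (intro sum_mono)
      fix a assume a: "a \<in> {..<n}"
      have "pinned (\<lambda>i. v i + d) a \<le> exp (d * real a) * pinned v a" using less a by simp
      also have "\<dots> \<le> exp (d * real (n - 1)) * pinned v a"
        using a assms by (intro mult_right_mono pinned_nonneg) (auto intro!: mult_left_mono)
      finally have le: "pinned (\<lambda>i. v i + d) a \<le> exp (d * real (n - 1)) * pinned v a" .
      show "pinned (\<lambda>i. v i + d) a * K (n - a) \<le> exp (d * real (n - 1)) * (pinned v a * K (n - a))"
        using mult_right_mono[OF le K_nonneg[of "n - a"]] by (simp only: mult.assoc)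
    qed
    then have "pinned (\<lambda>i. v i + d) n \<le> exp (v n + d) * (exp (d * real (n - 1)) * (\<Sum>a<n. pinned v a * K (n - a)))"
      unfolding sum_distrib_left[symmetric] using False
      by (subst pinned_pos_index) (auto intro: mult_left_mono)
    also have "\<dots> = exp (d * real n) * pinned v n"
      using False by (simp add: pinned_pos_index of_nat_diff algebra_simps flip: exp_add mult.assoc)
    finally show ?thesis .
  qed simp
qed

lemma free_add_const_le:
  assumes "d \<ge> 0"
  shows "free (\<lambda>i. v i + d) N \<le> exp (d * real N) * free v N"
  unfolding free_def sum_distrib_left
proof (intro sum_mono)
  fix a assume a: "a \<in> {..N}"
  have "pinned (\<lambda>i. v i + d) a \<le> exp (d * real a) * pinned v a" by (rule pinned_add_const_le[OF assms])
  also have "\<dots> \<le> exp (d * real N) * pinned v a"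
    using a assms by (intro mult_right_mono pinned_nonneg) (auto intro!: mult_left_mono)
  finally have le: "pinned (\<lambda>i. v i + d) a \<le> exp (d * real N) * pinned v a" .
  show "pinned (\<lambda>i. v i + d) a * tail (N - a) \<le> exp (d * real N) * (pinned v a * tail (N - a))"
    using mult_right_mono[OF le tail_nonneg[of "N - a"]] by (simp only: mult.assoc)
qed

lemma free_0 [simp]: "free v 0 = 1"
  by (simp add: free_def)

lemma free_nonneg: "0 \<le> free v N"
  unfolding free_def by (intro sum_nonneg mult_nonneg_nonneg pinned_nonneg tail_nonneg)

lemma entry_sum_nonneg: "0 \<le> entry_sum v M"
  unfolding entry_sum_def by (intro sum_nonneg mult_nonneg_nonneg free_nonneg) auto

text \<open>
  The configurations counted by the inner sum are those that renew at \<open>Suc N\<close>; only they feel the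
  new weight.
\<close>

lemma free_Suc:
  "free v (Suc N) = free v N + (exp (v (Suc N)) - 1) * (\<Sum>a\<le>N. pinned v a * K (Suc N - a))"
proof -
  have "free v (Suc N) = (\<Sum>a\<le>N. pinned v a * tail (Suc N - a)) + pinned v (Suc N)"
    by (simp add: free_def)
  also have "(\<Sum>a\<le>N. pinned v a * tail (Suc N - a))
      = (\<Sum>a\<le>N. pinned v a * tail (N - a) - pinned v a * K (Suc N - a))"
    by (intro sum.cong refl) (simp add: Suc_diff_le tail_Suc algebra_simps)
  also have "\<dots> = free v N - (\<Sum>a\<le>N. pinned v a * K (Suc N - a))"
    by (simp add: sum_subtractf free_def)
  finally show ?thesis
    by (simp add: pinned_pos_index lessThan_Suc_atMost algebra_simps)
qed

lemma free_le_1: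
  assumes "\<And>i. v i \<le> 0"
  shows "free v N \<le> 1"
proof -
  have "free v N \<le> free (\<lambda>_. 0) N" using assms by (intro free_mono) auto
  also have "free (\<lambda>_. 0) N = 1" by (induction N) (simp_all add: free_Suc)
  finally show ?thesis .
qed

lemma jump_sum_bounds:
  "0 \<le> (\<Sum>a\<le>N. pinned v a * K (Suc N - a))"
  "(\<Sum>a\<le>N. pinned v a * K (Suc N - a)) \<le> free v N"
  by (auto simp: free_def intro!: sum_nonneg sum_mono mult_left_mono mult_nonneg_nonneg pinned_nonneg K_nonneg K_le_tail)

lemma free_Suc_bounds:
  assumes "\<bar>v (Suc N)\<bar> \<le> C"
  shows "exp (-C) * free v N \<le> free v (Suc N)" "free v (Suc N) \<le> exp C * free v N"
proof -
  define q where "q = (\<Sum>a\<le>N. pinned v a * K (Suc N - a))"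
  have q: "0 \<le> q" "q \<le> free v N" unfolding q_def by (rule jump_sum_bounds)+
  have e: "exp (-C) \<le> exp (v (Suc N))" "exp (v (Suc N)) \<le> exp C" "exp (-C) \<le> 1" "1 \<le> exp C"
    using assms by auto
  have F: "free v (Suc N) = (free v N - q) + exp (v (Suc N)) * q"
    unfolding free_Suc q_def by (simp add: algebra_simps)
  have "exp (-C) * (free v N - q) \<le> free v N - q" "exp (-C) * q \<le> exp (v (Suc N)) * q"
    using q e mult_right_mono[of "exp (-C)" 1 "free v N - q"] by (auto intro: mult_right_mono)
  then show "exp (-C) * free v N \<le> free v (Suc N)" unfolding F by (simp add: right_diff_distrib)
  have "free v N - q \<le> exp C * (free v N - q)" "exp (v (Suc N)) * q \<le> exp C * q"
    using q e mult_right_mono[of 1 "exp C" "free v N - q"] by (auto intro: mult_right_mono)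
  then show "free v (Suc N) \<le> exp C * free v N" unfolding F by (simp add: right_diff_distrib)
qed

lemma free_pos: "0 < free v N"
proof (induction N)
  case (Suc N)
  have "0 < exp (- \<bar>v (Suc N)\<bar>) * free v N" using Suc by simp
  also have "\<dots> \<le> free v (Suc N)" by (rule free_Suc_bounds) simp
  finally show ?case .
qed simp

lemma free_le_exp:
  assumes "\<And>i. \<bar>v i\<bar> \<le> C"
  shows "free v N \<le> exp (C * real N)"
proof (induction N)
  case (Suc N)
  have "free v (Suc N) \<le> exp C * free v N" by (rule free_Suc_bounds) (rule assms)
  also have "\<dots> \<le> exp C * exp (C * real N)" using Suc by simp
  also have "\<dots> = exp (C * real (Suc N))" by (simp flip: exp_add add: algebra_simps)
  finally show ?case .
qed simp

lemma free_ge_exp: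
  assumes "\<And>i. \<bar>v i\<bar> \<le> C"
  shows "exp (- C * real N) \<le> free v N"
proof (induction N)
  case (Suc N)
  have "exp (- C * real (Suc N)) = exp (-C) * exp (- C * real N)" by (simp flip: exp_add add: algebra_simps)
  also have "\<dots> \<le> exp (-C) * free v N" using Suc by simp
  also have "\<dots> \<le> free v (Suc N)" by (rule free_Suc_bounds) (rule assms)
  finally show ?case .
qed simp

lemma abs_ln_free_le:
  assumes "\<And>i. \<bar>v i\<bar> \<le> C"
  shows "\<bar>ln (free v N)\<bar> \<le> C * real N"
proof -
  have "ln (exp (- C * real N)) \<le> ln (free v N)" "ln (free v N) \<le> ln (exp (C * real N))"
    using free_ge_exp[of v C N, OF assms] free_le_exp[of v C N, OF assms] free_pos[of v N]
    by (simp_all only: ln_le_cancel_iff exp_gt_zero)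
  then show ?thesis by simp
qed

subsection \<open>The renewal property\<close>

text \<open>
  A renewal whose first point is \<open>b\<close> with weight \<open>u b\<close> solves the linear recursion for \<open>y\<close>, and by
  linearity its solution is the superposition of the renewals started at the points \<open>b\<close>.
\<close>

lemma delayed_pinned:
  assumes y: "\<And>c. c \<ge> 1 \<Longrightarrow> y c = exp (v c) * (u c + (\<Sum>a=1..<c. y a * K (c - a)))"
    and "c \<ge> 1"
  shows "y c = (\<Sum>b=1..c. u b * exp (v b) * pinned (shifted b v) (c - b))"
  using \<open>c \<ge> 1\<close>
proof (induction c rule: less_induct)
  case (less c)
  let ?w = "\<lambda>b. u b * exp (v b)"
  have "(\<Sum>a=1..<c. y a * K (c - a))
      = (\<Sum>a=1..<c. \<Sum>b=1..a. ?w b * pinned (shifted b v) (a - b) * K (c - a))"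
    by (intro sum.cong refl) (simp only: less.IH atLeastLessThan_iff sum_distrib_right)
  also have "\<dots> = (\<Sum>b=1..<c. \<Sum>a=b..<c. ?w b * pinned (shifted b v) (a - b) * K (c - a))"
    using less.prems by (cases c) (simp_all only: atLeastLessThanSuc_atLeastAtMost sum_triangle_swap)
  finally have 1: "(\<Sum>a=1..<c. y a * K (c - a)) = (\<Sum>b=1..<c. \<Sum>a=b..<c. ?w b * pinned (shifted b v) (a - b) * K (c - a))" .
  have 2: "exp (v c) * (\<Sum>a=b..<c. ?w b * pinned (shifted b v) (a - b) * K (c - a))
      = ?w b * pinned (shifted b v) (c - b)" if b: "b \<in> {1..<c}" for b
  proof -
    have "(\<Sum>a=b..<c. pinned (shifted b v) (a - b) * K (c - a))
        = (\<Sum>i<c-b. pinned (shifted b v) i * K (c - b - i))"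
      by (rule sum.reindex_bij_witness[of _ "\<lambda>i. i + b" "\<lambda>a. a - b"]) auto
    then show ?thesis using b
      by (simp add: pinned_pos_index sum_distrib_left mult.assoc mult.left_commute flip: sum_distrib_left)
  qed
  have "y c = exp (v c) * u c + (\<Sum>b=1..<c. ?w b * pinned (shifted b v) (c - b))"
  proof -
    have "exp (v c) * (\<Sum>b=1..<c. \<Sum>a=b..<c. ?w b * pinned (shifted b v) (a - b) * K (c - a))
        = (\<Sum>b=1..<c. ?w b * pinned (shifted b v) (c - b))"
      by (subst sum_distrib_left) (intro sum.cong refl 2)
    then show ?thesis using y[OF less.prems] unfolding 1 by (simp only: distrib_left)
  qed
  also have "\<dots> = (\<Sum>b=1..c. ?w b * pinned (shifted b v) (c - b))"
  proof -
    have "{1..c} = insert c {1..<c}" using less.prems by auto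
    then show ?thesis by simp
  qed
  finally show ?case .
qed

lemma pinned_add:
  assumes "c \<ge> 1"
  shows "pinned v (N + c) = (\<Sum>b=1..c. (\<Sum>a\<le>N. pinned v a * K (N + b - a)) * exp (v (N + b))
           * pinned (shifted (N + b) v) (c - b))"
proof -
  have "pinned v (N + c) = (\<Sum>b=1..c. (\<Sum>a\<le>N. pinned v a * K (N + b - a)) * exp (shifted N v b)
           * pinned (shifted b (shifted N v)) (c - b))"
  proof (rule delayed_pinned[where y="\<lambda>c. pinned v (N + c)"])
    fix c :: nat assume c: "c \<ge> 1"
    have "(\<Sum>a<N + c. pinned v a * K (N + c - a)) = (\<Sum>a\<in>{..N} \<union> {N+1..<N+c}. pinned v a * K (N + c - a))"
      using c by (intro sum.cong) auto
    also have "\<dots> = (\<Sum>a\<le>N. pinned v a * K (N + c - a)) + (\<Sum>a=N+1..<N+c. pinned v a * K (N + c - a))"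
      by (rule sum.union_disjoint) auto
    also have "(\<Sum>a=N+1..<N+c. pinned v a * K (N + c - a)) = (\<Sum>a=1..<c. pinned v (N + a) * K (c - a))"
      by (rule sum.reindex_bij_witness[of _ "\<lambda>i. N + i" "\<lambda>a. a - N"]) (auto simp: add.commute)
    finally show "pinned v (N + c) = exp (shifted N v c) *
        ((\<Sum>a\<le>N. pinned v a * K (N + c - a)) + (\<Sum>a=1..<c. pinned v (N + a) * K (c - a)))"
      using c by (simp add: pinned_pos_index)
  qed fact
  then show ?thesis by (simp add: shifted_shifted)
qed

text \<open>
  The renewal property at \<open>N\<close>. Either the last renewal point lies up to \<open>N\<close>, or some jump goes from
  \<open>a \<le> N\<close> to \<open>N + b > N\<close> and the process starts afresh there. The weight \<open>f\<close> of the incomplete last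
  jump is arbitrary: it is used with \<open>tail\<close> and with an exponential.
\<close>

lemma weighted_pinned_add:
  "(\<Sum>c\<le>N + M. pinned v c * f (N + M - c)) =
     (\<Sum>a\<le>N. pinned v a * f (N + M - a)) +
     (\<Sum>b=1..M. (\<Sum>a\<le>N. pinned v a * K (N + b - a)) * exp (v (N + b)) *
        (\<Sum>c\<le>M - b. pinned (shifted (N + b) v) c * f (M - b - c)))"
proof -
  let ?q = "\<lambda>b. (\<Sum>a\<le>N. pinned v a * K (N + b - a)) * exp (v (N + b))"
  have "(\<Sum>c\<le>N + M. pinned v c * f (N + M - c)) = (\<Sum>c\<in>{..N} \<union> {N+1..N+M}. pinned v c * f (N + M - c))"
    by (intro sum.cong) auto
  also have "\<dots> = (\<Sum>a\<le>N. pinned v a * f (N + M - a)) + (\<Sum>c=N+1..N+M. pinned v c * f (N + M - c))"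
    by (rule sum.union_disjoint) auto
  also have "(\<Sum>c=N+1..N+M. pinned v c * f (N + M - c)) = (\<Sum>c=1..M. pinned v (N + c) * f (M - c))"
    by (rule sum.reindex_bij_witness[of _ "\<lambda>i. N + i" "\<lambda>a. a - N"]) (auto simp: add.commute)
  also have "\<dots> = (\<Sum>c=1..M. \<Sum>b=1..c. ?q b * pinned (shifted (N + b) v) (c - b) * f (M - c))"
    by (intro sum.cong refl) (simp add: pinned_add sum_distrib_right)
  also have "\<dots> = (\<Sum>b=1..M. \<Sum>c=b..M. ?q b * pinned (shifted (N + b) v) (c - b) * f (M - c))"
    by (rule sum_triangle_swap)
  also have "\<dots> = (\<Sum>b=1..M. ?q b * (\<Sum>c\<le>M - b. pinned (shifted (N + b) v) c * f (M - b - c)))"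
  proof (intro sum.cong refl)
    fix b assume "b \<in> {1..M}"
    then have "(\<Sum>c=b..M. pinned (shifted (N + b) v) (c - b) * f (M - c)) =
        (\<Sum>c\<le>M - b. pinned (shifted (N + b) v) c * f (M - b - c))"
      by (intro sum.reindex_bij_witness[of _ "\<lambda>i. i + b" "\<lambda>a. a - b"]) auto
    then show "(\<Sum>c=b..M. ?q b * pinned (shifted (N + b) v) (c - b) * f (M - c)) =
       ?q b * (\<Sum>c\<le>M - b. pinned (shifted (N + b) v) c * f (M - b - c))"
      by (simp add: mult.assoc flip: sum_distrib_left)
  qed
  finally show ?thesis .
qed

lemma free_add:
  "free v (N + M) = (\<Sum>a\<le>N. pinned v a * tail (N + M - a)) +
     (\<Sum>b=1..M. (\<Sum>a\<le>N. pinned v a * K (N + b - a)) * exp (v (N + b)) * free (shifted (N + b) v) (M - b))"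
  unfolding free_def by (rule weighted_pinned_add)

lemma free_first_step:
  "free v M = tail M + (\<Sum>b=1..M. K b * exp (v b) * free (shifted b v) (M - b))"
  using free_add[of v 0 M] by simp

text \<open>
  Given its last point \<open>a \<le> N\<close>, the renewal enters the window beyond \<open>N\<close> at any particular site with
  probability at most \<open>tail (N - a)\<close>, which is the factor with which \<open>a\<close> appears in \<open>free v N\<close>.
\<close>

lemma free_add_le: "free v (N + M) \<le> free v N * (1 + entry_sum (shifted N v) M)"
proof -
  have "(\<Sum>a\<le>N. pinned v a * tail (N + M - a)) \<le> free v N"
    unfolding free_def by (intro sum_mono mult_left_mono pinned_nonneg tail_antimono) auto
  moreover have "(\<Sum>a\<le>N. pinned v a * K (N + b - a)) \<le> free v N" if "b \<in> {1..M}" for b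
    unfolding free_def using that by (intro sum_mono mult_left_mono pinned_nonneg K_le_tail) auto
  then have "(\<Sum>b=1..M. (\<Sum>a\<le>N. pinned v a * K (N + b - a)) * exp (v (N + b)) * free (shifted (N + b) v) (M - b))
      \<le> (\<Sum>b=1..M. free v N * exp (v (N + b)) * free (shifted (N + b) v) (M - b))"
    by (intro sum_mono mult_right_mono free_nonneg) auto
  ultimately show ?thesis unfolding free_add
    by (simp add: entry_sum_def shifted_shifted sum_distrib_left distrib_left mult.assoc)
qed

subsection \<open>Exponentially discounted partition functions\<close>

text \<open>
  The partition function in which the incomplete last jump has an exponential weight instead of its
  probability. It can be extended into the next window at a cost that does not depend on the length
  of the incomplete jump; with \<open>tail\<close>, which is much larger than \<open>K\<close>, that would fail.
\<close>

definition discounted :: "real \<Rightarrow> (nat \<Rightarrow> real) \<Rightarrow> nat \<Rightarrow> real" where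
  "discounted l v N = (\<Sum>a\<le>N. pinned v a * exp (- l * real (N - a)))"

lemma discounted_ge: "exp (- l * real N) \<le> discounted l v N"
  using member_le_sum[of 0 "{..N}" "\<lambda>a. pinned v a * exp (- l * real (N - a))"]
  by (simp add: discounted_def pinned_nonneg)

lemma discounted_pos: "0 < discounted l v N"
  using discounted_ge[of l N v] exp_gt_zero[of "- l * real N"] by linarith

lemma discounted_le_free:
  assumes K: "\<And>n. n \<ge> n0 \<Longrightarrow> c * exp (- l * real n) \<le> K n" and "c > 0" "l \<ge> 0"
  shows "discounted l v N \<le> exp (l * real (Suc n0)) / c * free v N"
  unfolding discounted_def free_def sum_distrib_left
proof (intro sum_mono)
  fix a assume "a \<in> {..N}"
  have "c * exp (- l * real (N - a + Suc n0)) \<le> tail (N - a)"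
    using K[of "N - a + Suc n0"] K_le_tail[of "N - a" "N - a + Suc n0"] by simp
  then have "exp (l * real (Suc n0)) * (c * exp (- l * real (N - a + Suc n0))) \<le> exp (l * real (Suc n0)) * tail (N - a)"
    by (intro mult_left_mono) auto
  moreover have "exp (- l * real (N - a)) = exp (l * real (Suc n0)) * exp (- l * real (N - a + Suc n0))"
    unfolding exp_add[symmetric] by (simp add: algebra_simps)
  ultimately have "exp (- l * real (N - a)) \<le> exp (l * real (Suc n0)) / c * tail (N - a)"
    using \<open>c > 0\<close> by (subst times_divide_eq_left, subst pos_le_divide_eq) (simp_all only: mult_ac)
  then show "pinned v a * exp (- l * real (N - a)) \<le> exp (l * real (Suc n0)) / c * (pinned v a * tail (N - a))"
    using mult_left_mono[OF _ pinned_nonneg[of v a]] by (fastforce simp: mult_ac)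
qed

text \<open>
  Prolong the incomplete jump from \<open>a \<le> N\<close> to a site \<open>N + b\<close>. The site must lie beyond \<open>N + n0\<close>, since
  shorter jumps may have probability \<open>0\<close>, and this is why the window starts \<open>n0\<close> sites
  later. The summand \<open>1\<close> counts the paths that do not enter the window.
\<close>

lemma discounted_add_ge:
  assumes K: "\<And>n. n \<ge> n0 \<Longrightarrow> c * exp (- l * real n) \<le> K n" and "c > 0" "l \<ge> 0"
  shows "discounted l v N * exp (- l * real (n0 + M)) * (1 + c * exp (- l * real M) * entry_sum (shifted (N + n0) v) M)
           \<le> discounted l v (N + (n0 + M))"
proof -
  let ?E = "\<lambda>n. exp (- l * real n)"
  let ?D = "\<lambda>b. (\<Sum>i\<le>n0 + M - b. pinned (shifted (N + b) v) i * ?E (n0 + M - b - i))"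
  have add: "?E (m + n) = ?E m * ?E n" for m n
    by (simp add: algebra_simps flip: exp_add)
  have 1: "(\<Sum>a\<le>N. pinned v a * ?E (N + (n0 + M) - a)) = discounted l v N * ?E (n0 + M)"
    unfolding discounted_def sum_distrib_right
  proof (intro sum.cong refl)
    fix a assume "a \<in> {..N}"
    then have "N + (n0 + M) - a = (N - a) + (n0 + M)" by simp
    then show "pinned v a * ?E (N + (n0 + M) - a) = pinned v a * ?E (N - a) * ?E (n0 + M)"
      by (simp only: add mult.assoc)
  qed
  have 2: "c * ?E (n0 + M) * discounted l v N * exp (v (N + b)) * (?E M * free (shifted (N + b) v) (n0 + M - b))
      \<le> (\<Sum>a\<le>N. pinned v a * K (N + b - a)) * exp (v (N + b)) * ?D b" if b: "b \<in> {n0+1..n0+M}" for b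
  proof (intro mult_mono mult_nonneg_nonneg)
    have "c * ?E (n0 + M) * discounted l v N = (\<Sum>a\<le>N. pinned v a * (c * ?E (N - a + (n0 + M))))"
      unfolding discounted_def add by (simp add: sum_distrib_left mult_ac)
    also have "\<dots> \<le> (\<Sum>a\<le>N. pinned v a * K (N + b - a))"
    proof (intro sum_mono mult_left_mono pinned_nonneg)
      fix a assume "a \<in> {..N}"
      have "c * ?E (N - a + (n0 + M)) \<le> c * ?E (N + b - a)"
        using b \<open>c > 0\<close> \<open>l \<ge> 0\<close> \<open>a \<in> {..N}\<close> by (auto simp: of_nat_diff intro!: mult_left_mono)
      also have "\<dots> \<le> K (N + b - a)" using b \<open>a \<in> {..N}\<close> by (intro K) auto
      finally show "c * ?E (N - a + (n0 + M)) \<le> K (N + b - a)" .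
    qed
    finally show "c * ?E (n0 + M) * discounted l v N \<le> (\<Sum>a\<le>N. pinned v a * K (N + b - a))" .
    show "?E M * free (shifted (N + b) v) (n0 + M - b) \<le> ?D b"
      unfolding free_def sum_distrib_left
    proof (intro sum_mono)
      fix i assume "i \<in> {..n0 + M - b}"
      then have "?E M \<le> ?E (n0 + M - b - i)" 
        using b \<open>l \<ge> 0\<close> by (auto intro!: mult_left_mono)
      then have "?E M * tail (n0 + M - b - i) \<le> ?E (n0 + M - b - i)"
        using tail_le_1[of "n0 + M - b - i"] mult_mono[of "?E M" "?E (n0 + M - b - i)" "tail (n0 + M - b - i)" 1] tail_nonneg
        by simp
      then show "?E M * (pinned (shifted (N + b) v) i * tail (n0 + M - b - i)) \<le> pinned (shifted (N + b) v) i * ?E (n0 + M - b - i)"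
        using mult_left_mono[OF _ pinned_nonneg[of "shifted (N + b) v" i]] by (fastforce simp: mult_ac)
    qed
  qed (use \<open>c > 0\<close> in \<open>auto intro!: sum_nonneg mult_nonneg_nonneg pinned_nonneg K_nonneg free_nonneg less_imp_le[OF discounted_pos]\<close>)
  have "c * ?E (n0 + M) * discounted l v N * ?E M * entry_sum (shifted (N + n0) v) M
    = (\<Sum>b=n0+1..n0+M. c * ?E (n0 + M) * discounted l v N * exp (v (N + b)) * (?E M * free (shifted (N + b) v) (n0 + M - b)))"
    unfolding entry_sum_def sum_distrib_left
    by (intro sum.reindex_bij_witness[of _ "\<lambda>b. b - n0" "\<lambda>b. b + n0"]) (auto simp: shifted_shifted add_ac mult_ac)
  also have "\<dots> \<le> (\<Sum>b=n0+1..n0+M. (\<Sum>a\<le>N. pinned v a * K (N + b - a)) * exp (v (N + b)) * ?D b)"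
    by (intro sum_mono 2)
  also have "\<dots> \<le> (\<Sum>b=1..n0+M. (\<Sum>a\<le>N. pinned v a * K (N + b - a)) * exp (v (N + b)) * ?D b)"
    by (intro sum_mono2) (auto intro!: sum_nonneg mult_nonneg_nonneg pinned_nonneg K_nonneg)
  finally have 3: "c * ?E (n0 + M) * discounted l v N * ?E M * entry_sum (shifted (N + n0) v) M \<le> \<dots>" .
  have "discounted l v (N + (n0 + M)) = discounted l v N * ?E (n0 + M) +
      (\<Sum>b=1..n0+M. (\<Sum>a\<le>N. pinned v a * K (N + b - a)) * exp (v (N + b)) * ?D b)"
    using weighted_pinned_add[of v ?E N "n0 + M"] unfolding 1 by (simp add: discounted_def)
  then show ?thesis using 3 by (simp add: algebra_simps)
qed

subsection \<open>Homogeneous pinning\<close>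

lemma free_homogeneous_mono:
  assumes "d \<ge> 0" "m \<le> n"
  shows "free (\<lambda>_. d) m \<le> free (\<lambda>_. d) n"
proof (rule lift_Suc_mono_le[of "free (\<lambda>_. d)", OF _ \<open>m \<le> n\<close>])
  fix n
  have "0 \<le> (exp d - 1) * (\<Sum>a\<le>n. pinned (\<lambda>_. d) a * K (Suc n - a))"
    using \<open>d \<ge> 0\<close> jump_sum_bounds(1) by (intro mult_nonneg_nonneg) auto
  then show "free (\<lambda>_. d) n \<le> free (\<lambda>_. d) (Suc n)" unfolding free_Suc by simp
qed

text \<open>
  By recurrence the jumps shorter than some \<open>L\<close> have total probability so close to \<open>1\<close> that, with the
  reward \<open>exp d\<close>, their total weight \<open>r\<close> still exceeds \<open>1\<close>. Since the homogeneous partition function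
  increases with the length, enlarging the system by \<open>L\<close> multiplies it at least by \<open>r\<close>.
\<close>

lemma free_homogeneous_growth:
  assumes "d > 0"
  obtains L r where "L > 0" "r > 1" "\<And>j. r ^ j \<le> free (\<lambda>_. d) (j * L)"
proof -
  have "(\<lambda>n. exp d * (\<Sum>k<n. K k)) \<longlonglongrightarrow> exp d * 1"
    using K_sums unfolding sums_def by (intro tendsto_intros)
  moreover have "1 < exp d * 1" using assms by simp
  ultimately have "\<forall>\<^sub>F n in sequentially. 1 < exp d * (\<Sum>k<n. K k)" by (rule order_tendstoD)
  then obtain L where L: "1 < exp d * (\<Sum>k<L. K k)" by (auto simp: eventually_sequentially)
  define r where "r = exp d * (\<Sum>k<L. K k)"
  have "L > 0" using L by (cases L) auto
  have "r ^ j \<le> free (\<lambda>_. d) (j * L)" for j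
  proof (induction j)
    case (Suc j)
    have "(\<Sum>k<L. K k) = (\<Sum>k=1..<L. K k)"
      by (rule sum.mono_neutral_right) (auto simp: K_0 Suc_le_eq)
    also have "\<dots> \<le> (\<Sum>k=1..L. K k)" by (intro sum_mono2) (auto simp: K_nonneg)
    finally have 1: "(\<Sum>k<L. K k) \<le> (\<Sum>k=1..L. K k)" .
    have sh: "shifted b (\<lambda>_. d) = (\<lambda>_. d)" for b by (simp add: shifted_def)
    have "r ^ Suc j \<le> exp d * (\<Sum>k=1..L. K k) * free (\<lambda>_. d) (j * L)"
      unfolding power_Suc
      using Suc 1 L by (intro mult_mono) (auto simp: r_def intro!: mult_nonneg_nonneg sum_nonneg K_nonneg)
    also have "\<dots> = (\<Sum>b=1..L. K b * exp d * free (\<lambda>_. d) (j * L))"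
      by (simp add: sum_distrib_left sum_distrib_right mult_ac)
    also have "\<dots> \<le> (\<Sum>b=1..L. K b * exp d * free (\<lambda>_. d) (Suc j * L - b))"
      using assms by (intro sum_mono mult_left_mono free_homogeneous_mono) (auto simp: K_nonneg)
    also have "\<dots> \<le> (\<Sum>b=1..Suc j * L. K b * exp d * free (\<lambda>_. d) (Suc j * L - b))"
      by (intro sum_mono2) (auto intro!: mult_nonneg_nonneg K_nonneg free_nonneg)
    also have "\<dots> \<le> free (\<lambda>_. d) (Suc j * L)"
      by (subst (2) free_first_step) (simp add: sh tail_nonneg)
    finally show ?case .
  qed simp
  then show ?thesis using that[of L r] \<open>L > 0\<close> L unfolding r_def by blast
qed

lemma free_le_entry_sum:
  assumes "d \<ge> 0" "\<And>i. i \<in> {1..M} \<Longrightarrow> d \<le> v i" "M > 0"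
  shows "free (\<lambda>_. d) (M - 1) \<le> entry_sum v M"
proof -
  have "free (\<lambda>_. d) (M - 1) \<le> free (shifted 1 v) (M - 1)"
    using assms by (intro free_mono) auto
  also have "\<dots> \<le> exp (v 1) * free (shifted 1 v) (M - 1)"
    using assms(1) assms(2)[of 1] assms(3) free_nonneg[of "shifted 1 v" "M - 1"]
      mult_right_mono[of 1 "exp (v 1)" "free (shifted 1 v) (M - 1)"] by simp
  also have "\<dots> \<le> entry_sum v M"
    unfolding entry_sum_def using assms(3)
    by (intro member_le_sum[of 1 "{1..M}" "\<lambda>b. exp (v b) * free (shifted b v) (M - b)"])
      (auto intro!: mult_nonneg_nonneg free_nonneg)
  finally show ?thesis .
qed

end

section \<open>The renewal process and its kernel\<close>

locale renewal_process =
  fixes M :: "'a measure" and \<tau> :: "nat \<Rightarrow> 'a \<Rightarrow> nat"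
  assumes recurrent: "recurrent_renewal_process M \<tau>"
begin

abbreviation "\<xi> \<equiv> renewal_increment \<tau>"
abbreviation "K \<equiv> renewal_kernel M \<tau>"

sublocale prob_space M
  using recurrent by (simp add: recurrent_renewal_process_def)

lemma tau_measurable [measurable]: "\<tau> i \<in> measurable M (count_space UNIV)"
  and tau_0: "x \<in> space M \<Longrightarrow> \<tau> 0 x = 0"
  and tau_less_Suc: "x \<in> space M \<Longrightarrow> \<tau> i x < \<tau> (Suc i) x"
  and increments_indep: "indep_vars (\<lambda>_. count_space UNIV) \<xi> UNIV"
  and increments_distr: "distr M (count_space UNIV) (\<xi> i) = distr M (count_space UNIV) (\<xi> 0)"
  using recurrent unfolding recurrent_renewal_process_def by blast+

lemma increment_measurable [measurable]: "\<xi> i \<in> measurable M (count_space UNIV)"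
  using increments_indep by (auto simp: indep_vars_def)

text \<open>
  This makes \<open>\<tau> k\<close> a function of the first \<open>k\<close> increments, hence independent of \<open>\<xi> k\<close>.
\<close>

lemma tau_eq_sum: "x \<in> space M \<Longrightarrow> \<tau> k x = (\<Sum>j<k. \<xi> j x)"
proof (induction k)
  case (Suc k)
  then show ?case using tau_less_Suc[of x k] by (simp add: renewal_increment_def)
qed (simp add: tau_0)

lemma tau_strict_mono: "x \<in> space M \<Longrightarrow> strict_mono (\<lambda>i. \<tau> i x)"
  by (simp add: strict_mono_Suc_iff tau_less_Suc)

lemma prob_increment: "prob {x \<in> space M. \<xi> i x = n} = K n"
proof -
  have "measure (distr M (count_space UNIV) (\<xi> i)) {n} = measure (distr M (count_space UNIV) (\<xi> 0)) {n}"
    by (subst increments_distr) (rule refl)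
  then have "prob (\<xi> i -` {n} \<inter> space M) = prob (\<xi> 0 -` {n} \<inter> space M)"
    by (simp add: measure_distr)
  moreover have "\<xi> 0 -` {n} \<inter> space M = {x \<in> space M. \<tau> 1 x = n}"
    by (auto simp: renewal_increment_def tau_0)
  moreover have "\<xi> i -` {n} \<inter> space M = {x \<in> space M. \<xi> i x = n}" by auto
  ultimately show ?thesis by (simp add: renewal_kernel_def)
qed

sublocale renewal_law K
proof
  show "0 \<le> K n" for n by (simp add: renewal_kernel_def)
  have "{x \<in> space M. \<tau> 1 x = 0} = {}" using tau_less_Suc[of _ 0] by fastforce
  then show "K 0 = 0" by (simp only: renewal_kernel_def measure_empty)
  have "(\<lambda>n. prob {x \<in> space M. \<tau> 1 x = n}) sums prob (\<Union>n. {x \<in> space M. \<tau> 1 x = n})"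
    by (rule finite_measure_UNION) (auto simp: disjoint_family_on_def)
  also have "(\<Union>n. {x \<in> space M. \<tau> 1 x = n}) = space M" by auto
  finally show "K sums 1" by (simp add: prob_space renewal_kernel_def[abs_def])
qed

lemma expectation_increment: "expectation (\<lambda>x. of_bool (\<xi> i x = n) :: real) = K n"
proof -
  have "expectation (\<lambda>x. of_bool (\<xi> i x = n) :: real) = expectation (indicator {x \<in> space M. \<xi> i x = n})"
    by (intro Bochner_Integration.integral_cong) (auto simp: indicator_def)
  then show ?thesis by (simp add: prob_increment)
qed

lemma expectation_increment_gt: "expectation (\<lambda>x. of_bool (\<xi> i x > n) :: real) = tail n"
proof -
  have integ: "integrable M (\<lambda>x. of_bool (\<xi> i x = j) :: real)" for j
    by (rule integrable_const_bound[where B=1]) auto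
  have "expectation (\<lambda>x. of_bool (\<xi> i x > n) :: real) = expectation (\<lambda>x. 1 - (\<Sum>j\<le>n. of_bool (\<xi> i x = j)))"
  proof (rule Bochner_Integration.integral_cong[OF refl])
    fix x
    show "of_bool (\<xi> i x > n) = (1::real) - (\<Sum>j\<le>n. of_bool (\<xi> i x = j))"
      unfolding of_bool_def by (simp only: sum.delta' finite_atMost atMost_iff) simp
  qed
  also have "\<dots> = 1 - (\<Sum>j\<le>n. expectation (\<lambda>x. of_bool (\<xi> i x = j)))"
    by (simp add: integ Bochner_Integration.integrable_sum prob_space del: sum_of_bool_eq)
  finally show ?thesis by (simp add: expectation_increment tail_def del: sum_of_bool_eq)
qed

subsection \<open>Decomposition according to the number of renewals\<close>

text \<open>
  The Boltzmann weight of the first \<open>k\<close> renewals on the event that the last of them is \<open>a\<close>.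
\<close>

definition path_weight :: "(nat \<Rightarrow> real) \<Rightarrow> nat \<Rightarrow> nat \<Rightarrow> 'a \<Rightarrow> real" where
  "path_weight v k a x = exp (\<Sum>i=1..k. v (\<tau> i x)) * of_bool (\<tau> k x = a)"

lemma path_weight_measurable [measurable]: "path_weight v k a \<in> borel_measurable M"
  unfolding path_weight_def by measurable

lemma path_weight_integrable:
  assumes "\<And>n. \<bar>v n\<bar> \<le> C"
  shows "integrable M (path_weight v k a)"
proof (rule integrable_const_bound[where B="exp (real k * C)"])
  have "\<bar>\<Sum>i=1..k. v (\<tau> i x)\<bar> \<le> real k * C" for x
    using sum_bounded_above[of "{1..k}" "\<lambda>i. \<bar>v (\<tau> i x)\<bar>" C] assms
    by (intro order_trans[OF sum_abs]) simp
  then show "AE x in M. norm (path_weight v k a x) \<le> exp (real k * C)"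
    by (auto simp: path_weight_def abs_le_iff)
qed simp

lemma path_weight_indep_increment:
  fixes G :: "nat \<Rightarrow> real"
  assumes v: "\<And>n. \<bar>v n\<bar> \<le> C" and G: "\<And>n. \<bar>G n\<bar> \<le> 1"
  shows "integrable M (\<lambda>x. path_weight v k a x * G (\<xi> k x))"
    and "expectation (\<lambda>x. path_weight v k a x * G (\<xi> k x)) =
           expectation (path_weight v k a) * expectation (\<lambda>x. G (\<xi> k x))"
proof -
  define F where "F f = exp (\<Sum>i=1..k. v (\<Sum>j<i. f j)) * of_bool ((\<Sum>j<k. f j) = a)" for f :: "nat \<Rightarrow> nat"
  have sum_meas: "(\<lambda>f. \<Sum>j<i. f j) \<in> measurable (PiM {..<k} (\<lambda>_. count_space UNIV :: nat measure)) (count_space UNIV)" if "i \<le> k" for i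
  proof -
    have "(\<lambda>f. \<Sum>j<i. f j) \<in> borel_measurable (PiM {..<k} (\<lambda>_. borel :: nat measure))"
      using that by (intro borel_measurable_sum measurable_component_singleton) auto
    then show ?thesis
      by (subst measurable_cong_sets[where M'="PiM {..<k} (\<lambda>_. borel :: nat measure)" and N'=borel])
        (auto simp: sets_borel_eq_count_space intro!: sets_PiM_cong)
  qed
  have F: "F \<in> borel_measurable (PiM {..<k} (\<lambda>_. count_space UNIV))"
    unfolding F_def using sum_meas[of k]
    by (intro borel_measurable_times borel_measurable_exp borel_measurable_sum)
      (auto intro!: measurable_compose[OF sum_meas] )
  have GG: "(\<lambda>f. G (f k)) \<in> borel_measurable (PiM {k} (\<lambda>_. count_space UNIV))"
    by (rule measurable_compose[OF measurable_component_singleton]) auto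
  have "indep_var borel (F \<circ> (\<lambda>x. restrict (\<lambda>i. \<xi> i x) {..<k})) borel ((\<lambda>f. G (f k)) \<circ> (\<lambda>x. restrict (\<lambda>i. \<xi> i x) {k}))"
    by (intro indep_var_compose[OF indep_var_restrict[OF increments_indep]] F GG) auto
  moreover have W: "(F \<circ> (\<lambda>x. restrict (\<lambda>i. \<xi> i x) {..<k})) x = path_weight v k a x" if "x \<in> space M" for x
    using that by (auto simp: F_def path_weight_def tau_eq_sum intro!: sum.cong arg_cong[where f=exp] arg_cong[where f=v])
  moreover have "((\<lambda>f. G (f k)) \<circ> (\<lambda>x. restrict (\<lambda>i. \<xi> i x) {k})) = (\<lambda>x. G (\<xi> k x))"
    by auto
  ultimately have ind: "indep_var borel (F \<circ> (\<lambda>x. restrict (\<lambda>i. \<xi> i x) {..<k})) borel (\<lambda>x. G (\<xi> k x))"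
    by simp
  have int1: "integrable M (F \<circ> (\<lambda>x. restrict (\<lambda>i. \<xi> i x) {..<k}))"
    by (subst Bochner_Integration.integrable_cong[OF refl W]) (auto intro: path_weight_integrable v)
  have int2: "integrable M (\<lambda>x. G (\<xi> k x))"
    by (rule integrable_const_bound[where B=1]) (auto simp: G)
  show "integrable M (\<lambda>x. path_weight v k a x * G (\<xi> k x))"
    using indep_var_integrable[OF ind int1 int2]
    by (subst Bochner_Integration.integrable_cong[OF refl, where g="\<lambda>x. (F \<circ> (\<lambda>x. restrict (\<lambda>i. \<xi> i x) {..<k})) x * G (\<xi> k x)"]) (auto simp only: W)
  show "expectation (\<lambda>x. path_weight v k a x * G (\<xi> k x)) =
           expectation (path_weight v k a) * expectation (\<lambda>x. G (\<xi> k x))"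
    using indep_var_lebesgue_integral[OF ind int1 int2]
    by (simp only: W cong: Bochner_Integration.integral_cong)
qed

lemma path_weight_increment_eq:
  assumes v: "\<And>n. \<bar>v n\<bar> \<le> C"
  shows "integrable M (\<lambda>x. path_weight v k a x * of_bool (\<xi> k x = m))"
    and "expectation (\<lambda>x. path_weight v k a x * of_bool (\<xi> k x = m)) = expectation (path_weight v k a) * K m"
  using path_weight_indep_increment[OF v, where G="\<lambda>n. of_bool (n = m)" and k=k and a=a]
  by (simp_all add: expectation_increment)

lemma path_weight_increment_gt:
  assumes v: "\<And>n. \<bar>v n\<bar> \<le> C"
  shows "integrable M (\<lambda>x. path_weight v k a x * of_bool (\<xi> k x > m))"
    and "expectation (\<lambda>x. path_weight v k a x * of_bool (\<xi> k x > m)) = expectation (path_weight v k a) * tail m"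
  using path_weight_indep_increment[OF v, where G="\<lambda>n. of_bool (n > m)" and k=k and a=a]
  by (simp_all add: expectation_increment_gt)

lemma path_weight_Suc:
  assumes "x \<in> space M"
  shows "path_weight v (Suc k) b x = (\<Sum>a<b. exp (v b) * (path_weight v k a x * of_bool (\<xi> k x = b - a)))"
proof (cases "\<tau> (Suc k) x = b")
  case True
  then have lt: "\<tau> k x < b" using tau_less_Suc[OF assms, of k] by simp
  have "(\<Sum>a<b. exp (v b) * (path_weight v k a x * of_bool (\<xi> k x = b - a)))
      = (\<Sum>a\<in>{\<tau> k x}. exp (v b) * (path_weight v k a x * of_bool (\<xi> k x = b - a)))"
    using lt by (intro sum.mono_neutral_right) (auto simp: path_weight_def)
  also have "\<dots> = path_weight v (Suc k) b x"
    using True by (simp add: path_weight_def renewal_increment_def exp_add)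
  finally show ?thesis by simp
next
  case False
  have "path_weight v k a x * of_bool (\<xi> k x = b - a) = 0" if "a < b" for a
    using that False tau_less_Suc[OF assms, of k] by (auto simp: path_weight_def renewal_increment_def)
  then have "(\<Sum>a<b. exp (v b) * (path_weight v k a x * of_bool (\<xi> k x = b - a))) = 0"
    by (intro sum.neutral) auto
  then show ?thesis using False by (simp add: path_weight_def)
qed

text \<open>
  Together with the vanishing for \<open>k > a\<close>, this shows that the sum over the number \<open>k\<close> of renewals
  satisfies the recursion that defines \<open>pinned\<close>.
\<close>

lemma expectation_path_weight_Suc:
  assumes v: "\<And>n. \<bar>v n\<bar> \<le> C"
  shows "expectation (path_weight v (Suc k) b) = exp (v b) * (\<Sum>a<b. expectation (path_weight v k a) * K (b - a))"
proof -
  have "expectation (path_weight v (Suc k) b) =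
      expectation (\<lambda>x. \<Sum>a<b. exp (v b) * (path_weight v k a x * of_bool (\<xi> k x = b - a)))"
    by (intro Bochner_Integration.integral_cong refl path_weight_Suc)
  also have "\<dots> = (\<Sum>a<b. exp (v b) * expectation (\<lambda>x. path_weight v k a x * of_bool (\<xi> k x = b - a)))"
    by (simp add: path_weight_increment_eq[OF v] del: sum_mult_of_bool_eq)
  also have "\<dots> = (\<Sum>a<b. exp (v b) * (expectation (path_weight v k a) * K (b - a)))"
    by (simp only: path_weight_increment_eq[OF v])
  finally show ?thesis by (simp add: sum_distrib_left)
qed

lemma expectation_path_weight_eq_0: "a < k \<Longrightarrow> expectation (path_weight v k a) = 0"
proof -
  assume "a < k"
  have "path_weight v k a x = 0" if "x \<in> space M" for x
    using strict_mono_imp_increasing[OF tau_strict_mono[OF that], of k] \<open>a < k\<close> by (auto simp: path_weight_def)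
  then have "expectation (path_weight v k a) = expectation (\<lambda>_. 0)"
    by (intro Bochner_Integration.integral_cong) auto
  then show ?thesis by simp
qed

lemma pinned_eq_sum_path_weight:
  assumes v: "\<And>n. \<bar>v n\<bar> \<le> C"
  shows "b \<le> N \<Longrightarrow> (\<Sum>k\<le>N. expectation (path_weight v k b)) = pinned v b"
proof (induction b arbitrary: N rule: less_induct)
  case (less b)
  have w0: "expectation (path_weight v 0 b) = of_bool (b = 0)"
  proof -
    have "expectation (path_weight v 0 b) = expectation (\<lambda>x. of_bool (b = 0))"
      by (intro Bochner_Integration.integral_cong refl) (auto simp: path_weight_def tau_0)
    then show ?thesis by (simp add: prob_space)
  qed
  show ?case
  proof (cases "b = 0")
    case True
    have "(\<Sum>k\<le>N. expectation (path_weight v k b)) = (\<Sum>k\<in>{0}. expectation (path_weight v k b))"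
      using True by (intro sum.mono_neutral_right) (auto intro: expectation_path_weight_eq_0)
    then show ?thesis using True w0 by simp
  next
    case False
    then obtain N' where N': "N = Suc N'" using less.prems by (cases N) auto
    have "(\<Sum>k\<le>N. expectation (path_weight v k b)) = (\<Sum>k\<le>N'. expectation (path_weight v (Suc k) b))"
      unfolding N' using w0 False by (subst sum.atMost_Suc_shift) simp
    also have "\<dots> = exp (v b) * (\<Sum>a<b. (\<Sum>k\<le>N'. expectation (path_weight v k a)) * K (b - a))"
      unfolding expectation_path_weight_Suc[OF v] sum_distrib_left sum_distrib_right
      by (rule sum.swap)
    also have "(\<Sum>a<b. (\<Sum>k\<le>N'. expectation (path_weight v k a)) * K (b - a)) = (\<Sum>a<b. pinned v a * K (b - a))"
      using less N' by (intro sum.cong refl) (simp add: less.IH)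
    finally show ?thesis using False by (simp add: pinned_pos_index)
  qed
qed

text \<open>
  Exactly one \<open>k\<close> satisfies \<open>\<tau> k \<le> N < \<tau> (Suc k)\<close>, and the renewals in \<open>{1..N}\<close> are then
  \<open>\<tau> 1, \<dots>, \<tau> k\<close>. All other summands vanish.
\<close>

lemma boltzmann_weight_eq_sum:
  assumes x: "x \<in> space M"
  shows "exp (\<Sum>n=1..N. v n * renewal_indicator \<tau> n x) =
    (\<Sum>k\<le>N. \<Sum>a\<le>N. path_weight v k a x * of_bool (\<xi> k x > N - a))"
proof -
  note mono = tau_strict_mono[OF x]
  obtain k where k: "\<tau> k x \<le> N" "N < \<tau> (Suc k) x"
  proof -
    have "\<exists>j. N < \<tau> j x"
      using strict_mono_imp_increasing[OF mono, of "Suc N"] by (intro exI[of _ "Suc N"]) simp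
    then have "\<exists>k. \<not> N < \<tau> k x \<and> N < \<tau> (Suc k) x"
      using ex_least_nat_less[of "\<lambda>j. N < \<tau> j x"] tau_0[OF x] by (metis le_refl not_less_zero)
    then show ?thesis using that by (auto simp: not_less)
  qed
  have kN: "k \<le> N" using strict_mono_imp_increasing[OF mono, of k] k(1) by simp
  have uniq: "j = k" if "\<tau> j x \<le> N" "N < \<tau> (Suc j) x" for j
    using that k strict_mono_less[OF mono, of j "Suc k"] strict_mono_less[OF mono, of k "Suc j"] by simp
  have range: "{1..N} \<inter> range (\<lambda>i. \<tau> i x) = (\<lambda>i. \<tau> i x) ` {1..k}"
  proof safe
    fix i assume "\<tau> i x \<in> {1..N}"
    then have "\<tau> 0 x < \<tau> i x" "\<tau> i x < \<tau> (Suc k) x" using tau_0[OF x] k by auto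
    then show "\<tau> i x \<in> (\<lambda>i. \<tau> i x) ` {1..k}" using strict_mono_less[OF mono] by auto
  next
    fix i assume i: "i \<in> {1..k}"
    then have "\<tau> 0 x < \<tau> i x" "\<tau> i x \<le> \<tau> k x"
      using strict_mono_less[OF mono, of 0 i] strict_mono_less_eq[OF mono, of i k] by auto
    then show "\<tau> i x \<in> {1..N}" using k by auto
  qed auto
  have "(\<Sum>n=1..N. v n * renewal_indicator \<tau> n x) = (\<Sum>n\<in>{1..N} \<inter> range (\<lambda>i. \<tau> i x). v n)"
    by (subst sum.inter_restrict, simp, intro sum.cong refl) (simp add: renewal_indicator_def)
  also have "\<dots> = (\<Sum>i=1..k. v (\<tau> i x))"
    unfolding range using strict_mono_eq[OF mono] by (subst sum.reindex) (auto simp: inj_on_def)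
  finally have 1: "exp (\<Sum>n=1..N. v n * renewal_indicator \<tau> n x) = exp (\<Sum>i=1..k. v (\<tau> i x))" by simp
  have inner: "(\<Sum>a\<le>N. path_weight v j a x * of_bool (\<xi> j x > N - a)) =
      exp (\<Sum>i=1..j. v (\<tau> i x)) * of_bool (j = k)" for j
  proof (cases "\<tau> j x \<le> N")
    case True
    have "(\<Sum>a\<le>N. path_weight v j a x * of_bool (\<xi> j x > N - a)) =
        (\<Sum>a\<in>{\<tau> j x}. path_weight v j a x * of_bool (\<xi> j x > N - a))"
      using True by (intro sum.mono_neutral_right) (auto simp: path_weight_def)
    moreover have "\<xi> j x > N - \<tau> j x \<longleftrightarrow> j = k"
      using True uniq[of j] k tau_less_Suc[OF x, of j] by (auto simp: renewal_increment_def)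
    ultimately show ?thesis by (simp add: path_weight_def)
  next
    case False
    then have "j \<noteq> k" using k by auto
    moreover have "path_weight v j a x = 0" if "a \<le> N" for a using that False by (auto simp: path_weight_def)
    ultimately show ?thesis by simp
  qed
  show ?thesis unfolding 1 inner using kN by (simp add: of_bool_def if_distrib[of "(*) _"] cong: if_cong)
qed

lemma partition_function_eq_free:
  assumes v: "\<And>n. \<bar>h + \<beta> * w n\<bar> \<le> C"
  shows "pinning_partition_function M \<tau> w \<beta> h N = free (\<lambda>n. h + \<beta> * w n) N"
proof -
  let ?v = "\<lambda>n. h + \<beta> * w n"
  have "pinning_partition_function M \<tau> w \<beta> h N =
      expectation (\<lambda>x. \<Sum>k\<le>N. \<Sum>a\<le>N. path_weight ?v k a x * of_bool (\<xi> k x > N - a))"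
    unfolding pinning_partition_function_def
    by (intro Bochner_Integration.integral_cong refl boltzmann_weight_eq_sum)
  also have "\<dots> = (\<Sum>k\<le>N. \<Sum>a\<le>N. expectation (\<lambda>x. path_weight ?v k a x * of_bool (\<xi> k x > N - a)))"
    by (simp add: path_weight_increment_gt[OF v] del: sum_mult_of_bool_eq)
  also have "\<dots> = (\<Sum>k\<le>N. \<Sum>a\<le>N. expectation (path_weight ?v k a) * tail (N - a))"
    by (simp only: path_weight_increment_gt[OF v])
  also have "\<dots> = (\<Sum>a\<le>N. (\<Sum>k\<le>N. expectation (path_weight ?v k a)) * tail (N - a))"
    unfolding sum_distrib_right by (rule sum.swap)
  also have "\<dots> = free ?v N"
    unfolding free_def by (intro sum.cong refl) (simp add: pinned_eq_sum_path_weight[OF v])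
  finally show ?thesis .
qed

end

section \<open>Reading off exponential growth rates by telescoping\<close>

lemma lipschitz_real_seq:
  fixes g :: "nat \<Rightarrow> real"
  assumes "\<And>k. \<bar>g (Suc k) - g k\<bar> \<le> C"
  shows "\<bar>g (n + k) - g n\<bar> \<le> real k * C"
proof (induction k)
  case (Suc k)
  then show ?case using assms[of "n + k"] by (simp add: algebra_simps)
qed simp

text \<open>
  Summed over \<open>k < N\<close>, the increments \<open>a (k + R) - a k\<close> telescope to \<open>R\<close> values of \<open>a\<close> near \<open>N\<close>, which
  differ from \<open>g N\<close> by bounded amounts. Using increments of length \<open>R\<close> from every starting point avoids
  cutting \<open>{1..N}\<close> into blocks, which would require ergodicity of the \<open>R\<close>-fold shift. The
  sequence \<open>a\<close> need only be dominated by \<open>g\<close>, so that a partition function can be replaced by a smaller one.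
\<close>

lemma growth_rate_ge:
  fixes a g \<phi> :: "nat \<Rightarrow> real"
  assumes step: "\<And>k. \<phi> k \<le> a (k + R) - a k"
    and le: "\<And>k. a k \<le> g k + C'"
    and lip: "\<And>k. \<bar>g (Suc k) - g k\<bar> \<le> C"
    and "R > 0"
    and avg: "(\<lambda>N. (\<Sum>k<N. \<phi> k) / real N) \<longlonglongrightarrow> x"
    and "e > 0"
  shows "\<forall>\<^sub>F N in sequentially. x / real R - e \<le> g N / real N"
proof -
  define B where "B = real R * (real R * C + C') - (\<Sum>k<R. a k)"
  have C0: "0 \<le> C" using lip[of 0] by linarith
  have key: "(\<Sum>k<N. \<phi> k) \<le> real R * g N + B" for N
  proof -
    have "(\<Sum>k<N. \<phi> k) \<le> (\<Sum>k<N. a (k + R) - a k)" by (intro sum_mono step)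
    also have "\<dots> = (\<Sum>k<R. a (k + N)) - (\<Sum>k<R. a k)"
    proof (induction N)
      case (Suc N)
      have "(\<Sum>k<R. a (k + Suc N)) - (\<Sum>k<R. a (k + N)) = (\<Sum>k<R. a (Suc k + N) - a (k + N))"
        by (simp add: sum_subtractf)
      also have "\<dots> = a (R + N) - a N" using sum_lessThan_telescope[of "\<lambda>k. a (k + N)" R] by simp
      finally show ?case using Suc by (simp add: add.commute)
    qed simp
    also have "(\<Sum>k<R. a (k + N)) \<le> (\<Sum>k<R. g N + real R * C + C')"
    proof (intro sum_mono)
      fix k assume "k \<in> {..<R}"
      then have "real k * C \<le> real R * C" using C0 by (intro mult_right_mono) auto
      moreover have "g (N + k) - g N \<le> real k * C" using lipschitz_real_seq[of g C N k, OF lip] by linarith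
      ultimately show "a (k + N) \<le> g N + real R * C + C'" using le[of "k + N"] by (simp add: add.commute)
    qed
    finally show ?thesis by (simp add: B_def algebra_simps)
  qed
  have "(\<lambda>N. (\<Sum>k<N. \<phi> k) / real N - B / real N) \<longlonglongrightarrow> x - 0"
    by (intro tendsto_diff avg) real_asymp
  then have "\<forall>\<^sub>F N in sequentially. x - real R * e < (\<Sum>k<N. \<phi> k) / real N - B / real N"
    using \<open>e > 0\<close> \<open>R > 0\<close> by (intro order_tendstoD) auto
  then show ?thesis
    using eventually_gt_at_top[of 0]
  proof eventually_elim
    case (elim N)
    have "(\<Sum>k<N. \<phi> k) / real N - B / real N \<le> real R * (g N / real N)"
      using key[of N] elim(2) by (simp add: divide_simps)
    then have "x - real R * e \<le> real R * (g N / real N)" using elim(1) by linarith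
    then have "(x - real R * e) / real R \<le> g N / real N"
      using \<open>R > 0\<close> by (simp only: pos_divide_le_eq of_nat_0_less_iff mult.commute)
    then show ?case using \<open>R > 0\<close> by (simp add: diff_divide_distrib)
  qed
qed

section \<open>The quenched free energy\<close>

locale pinning_model = renewal_process M \<tau>
  for M :: "'a measure" and \<tau> +
  fixes Q :: "'b measure" and \<omega> :: "nat \<Rightarrow> 'b \<Rightarrow> real"
  assumes environment: "pinning_environment Q \<omega>"
begin

abbreviation "spins \<equiv> count_space {-1, 1 :: real}"

text \<open>
  The law of the environment on the space of sequences, where the shift acts; the space on which
  \<open>\<omega>\<close> itself lives has no shift.
\<close>

definition law :: "(nat \<Rightarrow> real) measure" where
  "law = sequence_law Q spins \<omega>"

definition potential :: "real \<Rightarrow> real \<Rightarrow> (nat \<Rightarrow> real) \<Rightarrow> nat \<Rightarrow> real" where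
  "potential \<beta> h w n = h + \<beta> * w n"

lemma prob_space_Q: "prob_space Q"
  and omega_measurable: "\<omega> i \<in> measurable Q spins"
  and omega_stationary: "stationary Q spins \<omega>"
  and omega_ergodic: "ergodic Q spins \<omega>"
  using environment by (simp_all add: pinning_environment_def random_sequence_def)

lemma omega_values: "y \<in> space Q \<Longrightarrow> \<omega> i y \<in> {-1, 1}"
  using measurable_space[OF omega_measurable] by auto

lemma omega_path_measurable: "(\<lambda>y i. \<omega> i y) \<in> measurable Q (PiM UNIV (\<lambda>_. spins))"
  by (rule measurable_PiM_single') (use omega_measurable omega_values in \<open>auto simp: PiE_def\<close>)

lemma law_eq: "law = distr Q (PiM UNIV (\<lambda>_. spins)) (\<lambda>y i. \<omega> i y)"
  by (simp add: law_def sequence_law_def)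

lemma sets_law: "sets law = sets (PiM UNIV (\<lambda>_. spins))"
  and space_law: "space law = space (PiM UNIV (\<lambda>_. spins))"
  by (simp_all add: law_eq)

lemma measurable_law: "measurable law N = measurable (PiM UNIV (\<lambda>_. spins)) N"
  by (rule measurable_cong_sets) (simp_all add: sets_law)

lemma space_lawD: "w \<in> space law \<Longrightarrow> w i \<in> {-1, 1}"
  by (auto simp: space_law space_PiM PiE_def Pi_def)

lemma component_measurable [measurable]: "(\<lambda>w. w i) \<in> borel_measurable law"
  unfolding measurable_law
  by (rule measurable_compose[OF measurable_component_singleton]) auto

lemma shifted_measurable: "shifted k \<in> measurable (PiM UNIV (\<lambda>_. spins)) (PiM UNIV (\<lambda>_. spins))"
  unfolding shifted_def by (rule measurable_PiM_single') (auto simp: space_PiM PiE_def Pi_def)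

sublocale env: ergodic_transformation law "shifted 1"
proof -
  interpret Q: prob_space Q by (rule prob_space_Q)
  interpret law: prob_space law
    unfolding law_eq by (rule Q.prob_space_distr) (rule omega_path_measurable)
  show "ergodic_transformation law (shifted 1)"
  proof
    show "shifted 1 \<in> law \<rightarrow>\<^sub>M law"
      unfolding measurable_law using shifted_measurable by (simp cong: measurable_cong_sets add: sets_law)
    have "distr law law (shifted 1) = distr law (PiM UNIV (\<lambda>_. spins)) (shifted 1)"
      by (rule distr_cong) (simp_all add: sets_law)
    also have "\<dots> = distr Q (PiM UNIV (\<lambda>_. spins)) (shifted 1 \<circ> (\<lambda>y i. \<omega> i y))"
      unfolding law_eq by (rule distr_distr[OF shifted_measurable omega_path_measurable])
    also have "shifted 1 \<circ> (\<lambda>y i. \<omega> i y) = (\<lambda>y i. \<omega> (Suc i) y)"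
      by (auto simp: shifted_def)
    also have "distr Q (PiM UNIV (\<lambda>_. spins)) (\<lambda>y i. \<omega> (Suc i) y) = law"
      using omega_stationary by (simp add: stationary_def sequence_law_def law_eq)
    finally show "distr law law (shifted 1) = law" .
    fix A assume A: "A \<in> sets law" "shifted 1 -` A \<inter> space law = A"
    then have "A \<in> shift_invariant_sets spins"
      by (auto simp: shift_invariant_sets_def sets_law space_law shifted_def)
    then show "law.prob A \<in> {0, 1}"
      using omega_ergodic by (simp add: ergodic_def law_def)
  qed
qed

lemma funpow_shifted: "(shifted 1 ^^ k) = shifted k"
  by (induction k) (auto simp: shifted_def fun_eq_iff)

lemma shifted_in_space: "w \<in> space law \<Longrightarrow> shifted k w \<in> space law"
  unfolding space_law by (rule measurable_space[OF shifted_measurable])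

lemma integral_comp_shifted:
  fixes f :: "(nat \<Rightarrow> real) \<Rightarrow> real"
  assumes "f \<in> borel_measurable law"
  shows "(\<integral>w. f (shifted k w) \<partial>law) = (\<integral>w. f w \<partial>law)"
proof (induction k)
  case (Suc k)
  have m: "(\<lambda>w. f (shifted k w)) \<in> borel_measurable law"
    using measurable_compose[OF shifted_measurable, of f borel k] assms unfolding measurable_law by simp
  have "(\<integral>w. f (shifted (Suc k) w) \<partial>law) = (\<integral>w. f (shifted k (shifted 1 w)) \<partial>law)"
    by (simp add: shifted_shifted)
  also have "\<dots> = (\<integral>w. f (shifted k w) \<partial>law)" by (rule env.integral_comp_T[OF m])
  finally show ?case by (simp only: Suc)
qed (simp add: shifted_def)

lemma AE_law_path: "AE w in law. R w \<Longrightarrow> AE y in Q. R (\<lambda>i. \<omega> i y)"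
  unfolding law_eq by (rule AE_distrD[OF omega_path_measurable])

lemma path_in_space: "y \<in> space Q \<Longrightarrow> (\<lambda>i. \<omega> i y) \<in> space law"
  unfolding space_law by (rule measurable_space[OF omega_path_measurable])

lemma birkhoff_environment:
  fixes f :: "(nat \<Rightarrow> real) \<Rightarrow> real"
  assumes "f \<in> borel_measurable law" "\<And>w. w \<in> space law \<Longrightarrow> \<bar>f w\<bar> \<le> B"
  shows "AE y in Q. (\<lambda>n. (\<Sum>k<n. f (shifted k (\<lambda>i. \<omega> i y))) / real n) \<longlonglongrightarrow> (\<integral>w. f w \<partial>law)"
  using AE_law_path[OF env.birkhoff[OF assms]] by (simp only: funpow_shifted)

subsection \<open>Measurability and boundedness\<close>

lemma shifted_potential: "shifted k (potential \<beta> h w) = potential \<beta> h (shifted k w)"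
  by (rule ext) (simp add: potential_def)

lemma potential_bound: "w \<in> space law \<Longrightarrow> \<bar>potential \<beta> h w n\<bar> \<le> \<bar>h\<bar> + \<bar>\<beta>\<bar>"
  using space_lawD[of w n] by (auto simp: potential_def)

lemma pinned_measurable [measurable]:
  assumes "\<And>n. (\<lambda>w. v w n) \<in> borel_measurable law"
  shows "(\<lambda>w. pinned (v w) n) \<in> borel_measurable law"
proof (induction n rule: less_induct)
  case (less n)
  show ?case
  proof (cases "n = 0")
    case False
    have [measurable]: "(\<lambda>w. \<Sum>a<n. pinned (v w) a * K (n - a)) \<in> borel_measurable law"
      using less by (intro borel_measurable_sum borel_measurable_times) auto
    show ?thesis using False assms[of n] by (simp add: pinned_pos_index)
  qed simp
qed

lemma free_measurable:
  assumes "\<And>n. (\<lambda>w. v w n) \<in> borel_measurable law"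
  shows "(\<lambda>w. free (v w) N) \<in> borel_measurable law"
  unfolding free_def using assms by measurable

lemma entry_sum_measurable [measurable]: "(\<lambda>w. entry_sum (potential \<beta> h w) m) \<in> borel_measurable law"
proof -
  have [measurable]: "(\<lambda>w. potential \<beta> h w n) \<in> borel_measurable law" for n
    unfolding potential_def by measurable
  have [measurable]: "(\<lambda>w. free (shifted b (potential \<beta> h w)) N) \<in> borel_measurable law" for b N
    by (rule free_measurable) simp
  show ?thesis unfolding entry_sum_def by measurable
qed

lemma entry_sum_bounded:
  obtains B where "\<And>w. w \<in> space law \<Longrightarrow> entry_sum (potential \<beta> h w) m \<le> B"
proof
  fix w assume w: "w \<in> space law"
  let ?C = "\<bar>h\<bar> + \<bar>\<beta>\<bar>"
  show "entry_sum (potential \<beta> h w) m \<le> (\<Sum>b=1..m. exp ?C * exp (?C * real (m - b)))"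
    unfolding entry_sum_def using potential_bound[OF w]
    by (intro sum_mono mult_mono free_le_exp) (auto simp: free_nonneg abs_le_iff)
qed

text \<open>
  For \<open>c = 1\<close> this bounds the gain in the logarithm of the partition function over one window from
  above; with \<open>c\<close> the cost of reaching the window by a long jump it bounds the gain from below.
\<close>

definition log_entry :: "real \<Rightarrow> real \<Rightarrow> real \<Rightarrow> nat \<Rightarrow> (nat \<Rightarrow> real) \<Rightarrow> real" where
  "log_entry \<beta> h c m w = ln (1 + c * entry_sum (potential \<beta> h w) m)"

lemma log_entry_measurable [measurable]: "log_entry \<beta> h c m \<in> borel_measurable law"
  unfolding log_entry_def by measurable

lemma log_entry_nonneg: "c \<ge> 0 \<Longrightarrow> 0 \<le> log_entry \<beta> h c m w"
  unfolding log_entry_def by (simp add: entry_sum_nonneg)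

lemma log_entry_bounded:
  assumes "c \<ge> 0"
  obtains B where "\<And>w. w \<in> space law \<Longrightarrow> \<bar>log_entry \<beta> h c m w\<bar> \<le> B"
proof -
  obtain B where B: "entry_sum (potential \<beta> h w) m \<le> B" if "w \<in> space law" for w
    using entry_sum_bounded by blast
  have "\<bar>log_entry \<beta> h c m w\<bar> \<le> ln (1 + c * B)" if "w \<in> space law" for w
    using B[OF that] log_entry_nonneg[OF assms, of \<beta> h m w] mult_left_mono[OF B[OF that] assms]
      mult_nonneg_nonneg[OF assms entry_sum_nonneg[of "potential \<beta> h w" m]]
    by (simp add: log_entry_def)
  then show thesis by (rule that)
qed

lemma log_entry_integrable: "c \<ge> 0 \<Longrightarrow> integrable law (log_entry \<beta> h c m)"
  by (rule log_entry_bounded[of c \<beta> h m], assumption)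
    (rule env.integrable_const_bound, auto)

subsection \<open>Upper and lower growth rates\<close>

lemma ln_free_lipschitz:
  assumes "\<And>n. \<bar>v n\<bar> \<le> C"
  shows "\<bar>ln (free v (Suc N)) - ln (free v N)\<bar> \<le> C"
proof -
  have "ln (exp (-C) * free v N) \<le> ln (free v (Suc N))" "ln (free v (Suc N)) \<le> ln (exp C * free v N)"
    using free_Suc_bounds[of v N C, OF assms] free_pos[of v N] free_pos[of v "Suc N"] by auto
  then show ?thesis using free_pos[of v N] by (simp add: ln_mult)
qed

lemma growth_rate_upper:
  assumes "m \<ge> 1"
  shows "AE y in Q. \<forall>e>0. \<forall>\<^sub>F N in sequentially.
    ln (free (potential \<beta> h (\<lambda>i. \<omega> i y)) N) / real N \<le> (\<integral>w. log_entry \<beta> h 1 m w \<partial>law) / real m + e"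
proof -
  obtain B where B: "\<bar>log_entry \<beta> h 1 m w\<bar> \<le> B" if "w \<in> space law" for w
    using log_entry_bounded[OF zero_le_one, of \<beta> h m] by blast
  show ?thesis
    using birkhoff_environment[OF log_entry_measurable B, simplified] AE_space
  proof eventually_elim
    case (elim y)
    let ?w = "\<lambda>i. \<omega> i y"
    let ?v = "potential \<beta> h ?w"
    have bound: "\<bar>?v n\<bar> \<le> \<bar>h\<bar> + \<bar>\<beta>\<bar>" for n by (rule potential_bound[OF path_in_space[OF elim(2)]])
    show ?case
    proof (intro allI impI)
      fix e :: real assume "e > 0"
      have "\<forall>\<^sub>F N in sequentially. (- (\<integral>w. log_entry \<beta> h 1 m w \<partial>law)) / real m - e \<le> - ln (free ?v N) / real N"
      proof (rule growth_rate_ge[where a="\<lambda>N. - ln (free ?v N)" and C'=0 and C="\<bar>h\<bar> + \<bar>\<beta>\<bar>"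
            and \<phi>="\<lambda>k. - log_entry \<beta> h 1 m (shifted k ?w)"])
        fix k
        have "ln (free ?v (k + m)) \<le> ln (free ?v k * (1 + entry_sum (shifted k ?v) m))"
          using free_add_le[of ?v k m] free_pos[of ?v "k + m"] by simp
        also have "\<dots> = ln (free ?v k) + log_entry \<beta> h 1 m (shifted k ?w)"
          using entry_sum_nonneg[of "shifted k ?v" m] free_pos[of ?v k]
          by (simp add: ln_mult log_entry_def shifted_potential)
        finally show "- log_entry \<beta> h 1 m (shifted k ?w) \<le> - ln (free ?v (k + m)) - - ln (free ?v k)" by simp
        show "\<bar>- ln (free ?v (Suc k)) - - ln (free ?v k)\<bar> \<le> \<bar>h\<bar> + \<bar>\<beta>\<bar>"
          using ln_free_lipschitz[of ?v "\<bar>h\<bar> + \<bar>\<beta>\<bar>" k, OF bound] by linarith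
        show "(\<lambda>N. (\<Sum>k<N. - log_entry \<beta> h 1 m (shifted k ?w)) / real N) \<longlonglongrightarrow> - (\<integral>w. log_entry \<beta> h 1 m w \<partial>law)"
          using tendsto_minus[OF elim(1)] by (simp add: sum_negf)
      qed (use assms \<open>e > 0\<close> in auto)
      then show "\<forall>\<^sub>F N in sequentially. ln (free ?v N) / real N \<le> (\<integral>w. log_entry \<beta> h 1 m w \<partial>law) / real m + e"
        by eventually_elim simp
    qed
  qed
qed

lemma growth_rate_lower:
  assumes K: "\<And>n. n \<ge> n0 \<Longrightarrow> c * exp (- l * real n) \<le> K n" and "c > 0" "l \<ge> 0" and "m \<ge> 1"
  shows "AE y in Q. \<forall>e>0. \<forall>\<^sub>F N in sequentially.
     - l + (\<integral>w. log_entry \<beta> h (c * exp (- l * real m)) m w \<partial>law) / real (n0 + m) - e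
       \<le> ln (free (potential \<beta> h (\<lambda>i. \<omega> i y)) N) / real N"
proof -
  let ?c = "c * exp (- l * real m)"
  have c: "?c \<ge> 0" using \<open>c > 0\<close> by simp
  obtain B where B: "\<bar>log_entry \<beta> h ?c m w\<bar> \<le> B" if "w \<in> space law" for w
    using log_entry_bounded[OF c, of \<beta> h m] by blast
  let ?f = "\<lambda>w. log_entry \<beta> h ?c m (shifted n0 w)"
  have f: "?f \<in> borel_measurable law"
    using measurable_compose[OF shifted_measurable, of "log_entry \<beta> h ?c m" borel n0] log_entry_measurable
    unfolding measurable_law by simp
  have B': "\<bar>?f w\<bar> \<le> B" if "w \<in> space law" for w
    using B[OF shifted_in_space[OF that]] .
  have int: "(\<integral>w. ?f w \<partial>law) = (\<integral>w. log_entry \<beta> h ?c m w \<partial>law)"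
    by (rule integral_comp_shifted) simp
  define R where "R = n0 + m"
  have "R > 0" using \<open>m \<ge> 1\<close> by (simp add: R_def)
  have "AE y in Q. (\<lambda>n. (\<Sum>k<n. ?f (shifted k (\<lambda>i. \<omega> i y))) / real n) \<longlonglongrightarrow> (\<integral>w. ?f w \<partial>law)"
    by (rule birkhoff_environment[OF f]) (rule B')
  then show ?thesis
    using AE_space
  proof eventually_elim
    case (elim y)
    let ?w = "\<lambda>i. \<omega> i y"
    let ?v = "potential \<beta> h ?w"
    have bound: "\<bar>?v n\<bar> \<le> \<bar>h\<bar> + \<bar>\<beta>\<bar>" for n by (rule potential_bound[OF path_in_space[OF elim(2)]])
    have avg: "(\<lambda>N. - l * R + (\<Sum>k<N. ?f (shifted k ?w)) / real N) \<longlonglongrightarrow> - l * R + (\<integral>w. log_entry \<beta> h ?c m w \<partial>law)"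
      by (rule tendsto_add[OF tendsto_const elim(1)[unfolded int]])
    show ?case
    proof (intro allI impI)
      fix e :: real assume "e > 0"
      have "\<forall>\<^sub>F N in sequentially. (- l * R + (\<integral>w. log_entry \<beta> h ?c m w \<partial>law)) / real R - e \<le> ln (free ?v N) / real N"
      proof (rule growth_rate_ge[where a="\<lambda>N. ln (discounted l ?v N)" and C'="ln (exp (l * real (Suc n0)) / c)" and C="\<bar>h\<bar> + \<bar>\<beta>\<bar>"
            and \<phi>="\<lambda>k. - l * R + ?f (shifted k ?w)"])
        fix k
        let ?E = "entry_sum (shifted (k + n0) ?v) m"
        have pos: "0 < 1 + ?c * ?E" using c entry_sum_nonneg[of "shifted (k + n0) ?v" m]
          by (simp add: add_pos_nonneg)
        have "ln (discounted l ?v k) + - l * R + ?f (shifted k ?w)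
            = ln (discounted l ?v k * exp (- l * real R) * (1 + ?c * ?E))"
          using discounted_pos[of l ?v k] pos
          by (simp add: ln_mult log_entry_def shifted_potential shifted_shifted add.commute)
        also have "\<dots> \<le> ln (discounted l ?v (k + R))"
          using discounted_add_ge[OF K \<open>c > 0\<close> \<open>l \<ge> 0\<close>, of n0 ?v k m] discounted_pos[of l ?v k] pos
          by (subst ln_le_cancel_iff) (auto simp: R_def discounted_pos)
        finally show "- l * R + ?f (shifted k ?w) \<le> ln (discounted l ?v (k + R)) - ln (discounted l ?v k)" by simp
        show "ln (discounted l ?v k) \<le> ln (free ?v k) + ln (exp (l * real (Suc n0)) / c)"
        proof -
          have "ln (discounted l ?v k) \<le> ln (exp (l * real (Suc n0)) / c * free ?v k)"
            using discounted_le_free[OF K \<open>c > 0\<close> \<open>l \<ge> 0\<close>, of n0 ?v k] \<open>c > 0\<close>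
            by (subst ln_le_cancel_iff) (auto simp: discounted_pos free_pos)
          also have "\<dots> = ln (exp (l * real (Suc n0)) / c) + ln (free ?v k)"
            using \<open>c > 0\<close> free_pos[of ?v k] by (simp add: ln_mult ln_div)
          finally show ?thesis by simp
        qed
        show "\<bar>ln (free ?v (Suc k)) - ln (free ?v k)\<bar> \<le> \<bar>h\<bar> + \<bar>\<beta>\<bar>"
          by (rule ln_free_lipschitz[OF bound])
        show "(\<lambda>N. (\<Sum>k<N. - l * R + ?f (shifted k ?w)) / real N) \<longlonglongrightarrow> - l * R + (\<integral>w. log_entry \<beta> h ?c m w \<partial>law)"
        proof (rule Lim_transform_eventually[OF avg])
          show "\<forall>\<^sub>F N in sequentially. - l * R + (\<Sum>k<N. ?f (shifted k ?w)) / real N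
              = (\<Sum>k<N. - l * R + ?f (shifted k ?w)) / real N"
            using eventually_gt_at_top[of 0] by eventually_elim (simp add: sum_subtractf diff_divide_distrib)
        qed
      qed (use \<open>R > 0\<close> \<open>e > 0\<close> in auto)
      then show "\<forall>\<^sub>F N in sequentially. - l + (\<integral>w. log_entry \<beta> h ?c m w \<partial>law) / real (n0 + m) - e
           \<le> ln (free ?v N) / real N"
        using \<open>R > 0\<close> unfolding R_def[symmetric] by (simp add: add_divide_distrib diff_divide_distrib)
    qed
  qed
qed

text \<open>
  The discount \<open>c\<close> costs at most its own logarithm. As \<open>c\<close> is of the form \<open>c' exp(- l m)\<close> with \<open>l\<close>
  small, this is a small fraction of the window length \<open>m\<close>.
\<close>

lemma log_entry_discount:
  assumes "0 < c" "c \<le> 1"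
  shows "ln c + log_entry \<beta> h 1 m w \<le> log_entry \<beta> h c m w"
proof -
  let ?E = "entry_sum (potential \<beta> h w) m"
  have E: "0 \<le> ?E" by (rule entry_sum_nonneg)
  have "ln c + ln (1 + ?E) = ln (c * (1 + ?E))" using assms E by (simp add: ln_mult)
  also have "\<dots> \<le> ln (1 + c * ?E)"
    using assms E by (subst ln_le_cancel_iff) (auto simp: distrib_left intro!: add_pos_nonneg mult_nonneg_nonneg)
  finally show ?thesis by (simp add: log_entry_def)
qed

text \<open>
  Let \<open>F\<close> be the infimum over \<open>m\<close> of the upper rates \<open>u m / m\<close>. The lower rate for a window of
  length \<open>m\<close> is at least \<open>- l + (log c - l m + u m) / (n0 + m)\<close>, where \<open>u m \<ge> m F\<close>. As \<open>m\<close> grows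
  this tends to at least \<open>F - 2 l\<close>, and \<open>l\<close> is arbitrary.
\<close>

theorem growth_rate_exists:
  assumes K: "\<And>l. l > 0 \<Longrightarrow> \<exists>c n0. 0 < c \<and> c \<le> 1 \<and> (\<forall>n\<ge>n0. c * exp (- l * real n) \<le> K n)"
  shows "\<exists>F. AE y in Q. (\<lambda>N. ln (free (potential \<beta> h (\<lambda>i. \<omega> i y)) N) / real N) \<longlonglongrightarrow> F"
proof -
  let ?u = "\<lambda>m. \<integral>w. log_entry \<beta> h 1 m w \<partial>law"
  define F where "F = (INF m\<in>{1..}. ?u m / real m)"
  have u0: "0 \<le> ?u m" for m by (rule Bochner_Integration.integral_nonneg) (simp add: log_entry_nonneg)
  have bdd: "bdd_below ((\<lambda>m. ?u m / real m) ` {1..})"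
    by (intro bdd_belowI[where m=0]) (auto simp: u0)
  have F_le: "F \<le> ?u m / real m" if "m \<ge> 1" for m
    unfolding F_def using that by (intro cINF_lower bdd) auto
  let ?l = "\<lambda>j. 1 / real (Suc j)"
  have "\<forall>j. \<exists>c n0. 0 < c \<and> c \<le> 1 \<and> (\<forall>n\<ge>n0. c * exp (- ?l j * real n) \<le> K n)"
    using K[of "?l _"] by auto
  then obtain c n0 where c: "0 < c j" "c j \<le> 1" and Kj: "\<And>n. n \<ge> n0 j \<Longrightarrow> c j * exp (- ?l j * real n) \<le> K n" for j
    by metis
  let ?\<psi> = "\<lambda>j m. \<integral>w. log_entry \<beta> h (c j * exp (- ?l j * real m)) m w \<partial>law"
  let ?g = "\<lambda>y N. ln (free (potential \<beta> h (\<lambda>i. \<omega> i y)) N) / real N"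
  \<comment> \<open>Only countably many windows \<open>m\<close> and rates \<open>?l j\<close> are used, so one null set suffices.\<close>
  have low: "AE y in Q. \<forall>j m. m \<ge> 1 \<longrightarrow> (\<forall>e>0. \<forall>\<^sub>F N in sequentially. - ?l j + ?\<psi> j m / real (n0 j + m) - e \<le> ?g y N)"
    unfolding AE_all_countable
  proof (intro allI)
    fix j m
    show "AE y in Q. m \<ge> 1 \<longrightarrow> (\<forall>e>0. \<forall>\<^sub>F N in sequentially. - ?l j + ?\<psi> j m / real (n0 j + m) - e \<le> ?g y N)"
      using growth_rate_lower[of "n0 j" "c j" "?l j" m \<beta> h, OF Kj c(1)] by (cases "m \<ge> 1") simp_all
  qed
  have up: "AE y in Q. \<forall>m. m \<ge> 1 \<longrightarrow> (\<forall>e>0. \<forall>\<^sub>F N in sequentially. ?g y N \<le> ?u m / real m + e)"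
    unfolding AE_all_countable
  proof (intro allI)
    fix m
    show "AE y in Q. m \<ge> 1 \<longrightarrow> (\<forall>e>0. \<forall>\<^sub>F N in sequentially. ?g y N \<le> ?u m / real m + e)"
      using growth_rate_upper[of m \<beta> h] by (cases "m \<ge> 1") simp_all
  qed
  have "AE y in Q. ?g y \<longlonglongrightarrow> F"
    using low up
  proof eventually_elim
    case (elim y)
    show ?case
    proof (rule order_tendstoI)
      fix x assume "F < x"
      then obtain m where m: "m \<ge> 1" "?u m / real m < x"
        unfolding F_def using cINF_less_iff[OF _ bdd] by auto
      then have "\<forall>\<^sub>F N in sequentially. ?g y N \<le> ?u m / real m + (x - ?u m / real m) / 2"
        using elim(2) by simp
      then show "\<forall>\<^sub>F N in sequentially. ?g y N < x"
      proof eventually_elim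
        case (elim N)
        then show ?case using m(2) by (simp add: field_simps)
      qed
    next
      fix x assume "x < F"
      then obtain j where j: "?l j < (F - x) / 3"
        using reals_Archimedean[of "(F - x) / 3"] by (auto simp: inverse_eq_divide)
      have "(\<lambda>m. - ?l j + (ln (c j) - ?l j * real m + real m * F) / real (n0 j + m)) \<longlonglongrightarrow> - ?l j + (F - ?l j)"
        by real_asymp
      moreover have "x + ?l j < - ?l j + (F - ?l j)"
      proof -
        have "x + t < - t + (F - t)" if "t < (F - x) / 3" for t using that by simp
        then show ?thesis using j .
      qed
      ultimately have "\<forall>\<^sub>F m in sequentially. x + ?l j < - ?l j + (ln (c j) - ?l j * real m + real m * F) / real (n0 j + m)"
        by (rule order_tendstoD)
      then obtain m where m: "m \<ge> 1" "x + ?l j < - ?l j + (ln (c j) - ?l j * real m + real m * F) / real (n0 j + m)"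
        by (metis (no_types, lifting) eventually_sequentially nat_le_linear)
      have "real m * F \<le> ?u m" using F_le[OF m(1)] m(1) by (simp add: field_simps)
      then have "ln (c j) - ?l j * real m + real m * F \<le> ln (c j * exp (- ?l j * real m)) + ?u m"
        using c(1)[of j] by (simp add: ln_mult)
      also have "\<dots> = (\<integral>w. ln (c j * exp (- ?l j * real m)) + log_entry \<beta> h 1 m w \<partial>law)"
        by (simp add: log_entry_integrable env.prob_space)
      also have "\<dots> \<le> ?\<psi> j m"
      proof (intro integral_mono log_entry_discount)
        show "c j * exp (- ?l j * real m) \<le> 1" using c(1,2)[of j] by (intro mult_le_one) auto
      qed (use c(1)[of j] in \<open>auto intro!: log_entry_integrable\<close>)
      finally have "(ln (c j) - ?l j * real m + real m * F) / real (n0 j + m) \<le> ?\<psi> j m / real (n0 j + m)"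
        by (intro divide_right_mono) auto
      then have x: "x + ?l j < - ?l j + ?\<psi> j m / real (n0 j + m)" using m(2) by linarith
      have "?l j > 0" by simp
      then have "\<forall>\<^sub>F N in sequentially. - ?l j + ?\<psi> j m / real (n0 j + m) - ?l j \<le> ?g y N"
        using elim(1) m(1) by blast
      then show "\<forall>\<^sub>F N in sequentially. x < ?g y N"
        by eventually_elim (use x in linarith)
    qed
  qed
  then show ?thesis by blast
qed

end

section \<open>Free energy and critical point\<close>

locale polynomial_pinning_model = pinning_model M \<tau> Q \<omega>
  for M :: "'a measure" and \<tau> and Q :: "'b measure" and \<omega> +
  fixes s c0 :: real and n0 :: nat
  assumes s_pos: "s > 0" and c0: "0 < c0" "c0 \<le> 1"
    and kernel_ge: "n \<ge> n0 \<Longrightarrow> c0 * real n powr (- s) \<le> K n"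
    and n0_pos: "n0 \<ge> 1"
begin

abbreviation "F \<equiv> quenched_free_energy M \<tau> Q \<omega>"
abbreviation "env_path y \<equiv> (\<lambda>i. \<omega> i y)"

text \<open>
  The tangent of the logarithm at \<open>D\<close> turns the polynomial bound into an exponential one with rate
  \<open>s / D\<close> and a prefactor that is polynomial in \<open>D\<close>. Large \<open>D\<close> gives arbitrarily small rates.
\<close>

lemma kernel_exp_ge:
  assumes "D > 0" "n \<ge> n0"
  shows "c0 * D powr (- s) * exp (- (s / D) * real n) \<le> K n"
proof -
  have n: "n \<ge> 1" using assms n0_pos by simp
  have "ln (real n / D) \<le> real n / D - 1" using n assms by (intro ln_le_minus_one) auto
  then have "ln (real n) \<le> ln D + real n / D" using n assms by (simp add: ln_div)
  then have "s * ln (real n) \<le> s * (ln D + real n / D)" using s_pos by (intro mult_left_mono) auto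
  then have "D powr (- s) * exp (- (s / D) * real n) \<le> real n powr (- s)"
    using n assms by (simp add: powr_def algebra_simps flip: exp_add)
  then have "c0 * (D powr (- s) * exp (- (s / D) * real n)) \<le> c0 * real n powr (- s)"
    using c0 by (intro mult_left_mono) auto
  also have "\<dots> \<le> K n" by (rule kernel_ge[OF assms(2)])
  finally show ?thesis by (simp add: mult.assoc)
qed

lemma AE_Q_ex: "AE y in Q. R y \<Longrightarrow> \<exists>y\<in>space Q. R y"
proof -
  interpret Q: prob_space Q by (rule prob_space_Q)
  assume "AE y in Q. R y"
  then have "AE y in Q. y \<in> space Q \<and> R y" by (auto simp: AE_conj_iff)
  then show ?thesis using eventually_happens'[OF Q.ae_filter_bot] by blast
qed

lemma free_energy_limit:
  "AE y in Q. (\<lambda>N. ln (free (potential \<beta> h (env_path y)) N) / real N) \<longlonglongrightarrow> F \<beta> h"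
proof -
  have "\<exists>c n0. 0 < c \<and> c \<le> 1 \<and> (\<forall>n\<ge>n0. c * exp (- l * real n) \<le> K n)" if "l > 0" for l
  proof -
    define D where "D = max 1 (s / l)"
    have D: "D \<ge> 1" "s / D \<le> l" using that s_pos
      by (auto simp: D_def max_def field_simps)
    have "D powr (- s) \<le> 1" using D s_pos by (simp add: powr_le_one_le powr_minus inverse_le_1_iff ge_one_powr_ge_zero)
    then have "c0 * D powr (- s) \<le> 1" using c0 by (intro mult_le_one) auto
    moreover have "c0 * D powr (- s) * exp (- l * real n) \<le> K n" if "n \<ge> n0" for n
    proof -
      have "c0 * D powr (- s) * exp (- l * real n) \<le> c0 * D powr (- s) * exp (- (s / D) * real n)"
        using mult_right_mono[OF D(2), of "real n"] c0 by (intro mult_left_mono) auto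
      also have "\<dots> \<le> K n" using D that by (intro kernel_exp_ge) auto
      finally show ?thesis .
    qed
    ultimately show ?thesis using c0 D by (intro exI[of _ "c0 * D powr (- s)"] exI[of _ n0]) auto
  qed
  then obtain L where L: "AE y in Q. (\<lambda>N. ln (free (potential \<beta> h (env_path y)) N) / real N) \<longlonglongrightarrow> L"
    using growth_rate_exists by blast
  have pf: "1 / real N * ln (pinning_partition_function M \<tau> (env_path y) \<beta> h N) =
      ln (free (potential \<beta> h (env_path y)) N) / real N" if "y \<in> space Q" for y N
    using partition_function_eq_free[of h \<beta> "env_path y" "\<bar>h\<bar> + \<bar>\<beta>\<bar>" N] potential_bound[OF path_in_space[OF that], of \<beta> h]
    by (simp add: potential_def[abs_def])
  have L': "AE y in Q. (\<lambda>N. 1 / real N * ln (pinning_partition_function M \<tau> (env_path y) \<beta> h N)) \<longlonglongrightarrow> L"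
    using L AE_space by eventually_elim (simp only: pf)
  have "F \<beta> h = L"
    unfolding quenched_free_energy_def
  proof (rule the_equality)
    fix f assume "AE y in Q. (\<lambda>N. 1 / real N * ln (pinning_partition_function M \<tau> (env_path y) \<beta> h N)) \<longlonglongrightarrow> f"
    then have "AE y in Q. f = L" using L' by eventually_elim (rule LIMSEQ_unique)
    then show "f = L" using AE_Q_ex by blast
  qed (rule L')
  then show ?thesis using L by simp
qed

lemma free_energy_compare:
  assumes "\<And>y N. y \<in> space Q \<Longrightarrow> N \<ge> 1 \<Longrightarrow>
      ln (free (potential \<beta> h (env_path y)) N) / real N \<le> ln (free (potential \<beta>' h' (env_path y)) N) / real N + d"
  shows "F \<beta> h \<le> F \<beta>' h' + d"
proof -
  obtain y where y: "y \<in> space Q"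
    and l: "(\<lambda>N. ln (free (potential \<beta> h (env_path y)) N) / real N) \<longlonglongrightarrow> F \<beta> h"
    and l': "(\<lambda>N. ln (free (potential \<beta>' h' (env_path y)) N) / real N) \<longlonglongrightarrow> F \<beta>' h'"
    using AE_Q_ex[OF AE_conjI[OF free_energy_limit[of \<beta> h] free_energy_limit[of \<beta>' h']]] by blast
  show ?thesis
    by (rule LIMSEQ_le[OF l tendsto_add[OF l' tendsto_const]]) (use assms[OF y] in blast)
qed

lemma free_energy_mono:
  assumes "h \<le> h'"
  shows "F \<beta> h \<le> F \<beta> h'"
proof -
  have "F \<beta> h \<le> F \<beta> h' + 0"
  proof (rule free_energy_compare)
    fix y N
    have "free (potential \<beta> h (env_path y)) N \<le> free (potential \<beta> h' (env_path y)) N"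
      using assms by (intro free_mono) (simp add: potential_def)
    then show "ln (free (potential \<beta> h (env_path y)) N) / real N \<le> ln (free (potential \<beta> h' (env_path y)) N) / real N + 0"
      by (auto intro!: divide_right_mono ln_mono free_pos)
  qed
  then show ?thesis by simp
qed

lemma free_energy_lipschitz:
  assumes "h \<le> h'"
  shows "F \<beta> h' \<le> F \<beta> h + (h' - h)"
proof (rule free_energy_compare)
  fix y and N :: nat assume N: "N \<ge> 1"
  have "potential \<beta> h' (env_path y) = (\<lambda>i. potential \<beta> h (env_path y) i + (h' - h))"
    by (rule ext) (simp add: potential_def)
  then have "free (potential \<beta> h' (env_path y)) N \<le> exp ((h' - h) * real N) * free (potential \<beta> h (env_path y)) N"
    using free_add_const_le[of "h' - h"] assms by simp
  then have "ln (free (potential \<beta> h' (env_path y)) N) \<le> ln (exp ((h' - h) * real N) * free (potential \<beta> h (env_path y)) N)"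
    using free_pos by (subst ln_le_cancel_iff) auto
  also have "\<dots> = (h' - h) * real N + ln (free (potential \<beta> h (env_path y)) N)"
    using free_pos[of "potential \<beta> h (env_path y)" N] by (simp add: ln_mult)
  finally show "ln (free (potential \<beta> h' (env_path y)) N) / real N \<le> ln (free (potential \<beta> h (env_path y)) N) / real N + (h' - h)"
    using N by (simp add: field_simps)
qed

lemma free_energy_nonpos:
  assumes "h \<le> - \<bar>\<beta>\<bar>"
  shows "F \<beta> h \<le> 0"
proof -
  obtain y where y: "y \<in> space Q"
    and l: "(\<lambda>N. ln (free (potential \<beta> h (env_path y)) N) / real N) \<longlonglongrightarrow> F \<beta> h"
    using AE_Q_ex[OF free_energy_limit[of \<beta> h]] by blast
  have "free (potential \<beta> h (env_path y)) N \<le> 1" for N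
  proof (rule free_le_1)
    show "potential \<beta> h (env_path y) i \<le> 0" for i
      using omega_values[OF y, of i] assms by (auto simp: potential_def)
  qed
  then have "ln (free (potential \<beta> h (env_path y)) N) / real N \<le> 0" for N
    using free_pos[of _ N] by (simp add: divide_nonpos_nonneg)
  then show ?thesis by (intro LIMSEQ_le_const2[OF l]) auto
qed

text \<open>
  For \<open>h > \<bar>\<beta>\<bar>\<close> every site is favourable and the homogeneous growth applies along multiples of \<open>L\<close>.
\<close>

lemma free_energy_pos_large_field:
  assumes "h > \<bar>\<beta>\<bar>"
  shows "F \<beta> h > 0"
proof -
  define d where "d = h - \<bar>\<beta>\<bar>"
  have "d > 0" using assms by (simp add: d_def)
  then obtain L r where L: "L > 0" "r > 1" and growth: "\<And>j. r ^ j \<le> free (\<lambda>_. d) (j * L)"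
    using free_homogeneous_growth[of d] by metis
  obtain y where y: "y \<in> space Q"
    and l: "(\<lambda>N. ln (free (potential \<beta> h (env_path y)) N) / real N) \<longlonglongrightarrow> F \<beta> h"
    using AE_Q_ex[OF free_energy_limit[of \<beta> h]] by blast
  have "strict_mono (\<lambda>j. j * L)" using L by (simp add: strict_mono_def)
  from LIMSEQ_subseq_LIMSEQ[OF l this]
  have l': "(\<lambda>j. ln (free (potential \<beta> h (env_path y)) (j * L)) / real (j * L)) \<longlonglongrightarrow> F \<beta> h" by (simp add: o_def)
  have "ln r / real L \<le> ln (free (potential \<beta> h (env_path y)) (j * L)) / real (j * L)" if "j \<ge> 1" for j
  proof -
    have "free (\<lambda>_. d) (j * L) \<le> free (potential \<beta> h (env_path y)) (j * L)"
    proof (rule free_mono)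
      show "d \<le> potential \<beta> h (env_path y) i" for i
        using omega_values[OF y, of i] by (auto simp: potential_def d_def)
    qed
    then have "r ^ j \<le> free (potential \<beta> h (env_path y)) (j * L)" using growth[of j] by linarith
    then have "ln (r ^ j) \<le> ln (free (potential \<beta> h (env_path y)) (j * L))"
      using L free_pos by (subst ln_le_cancel_iff) auto
    then have "real j * ln r / real (j * L) \<le> ln (free (potential \<beta> h (env_path y)) (j * L)) / real (j * L)"
      using L by (intro divide_right_mono) (simp_all add: ln_realpow)
    then show ?thesis using that by simp
  qed
  then have "ln r / real L \<le> F \<beta> h" by (intro LIMSEQ_le_const[OF l']) auto
  moreover have "0 < ln r / real L" using L by simp
  ultimately show ?thesis by linarith
qed

text \<open>
  The set of \<open>h\<close> with positive free energy is an up-set, is nonempty and bounded below, and does not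
  contain its infimum because the free energy is continuous. So the definite description defining
  the critical point is satisfied by this infimum, and by nothing else.
\<close>

lemma critical_point_iff: "F \<beta> h > 0 \<longleftrightarrow> h > quenched_critical_point M \<tau> Q \<omega> \<beta>"
proof -
  define S where "S = {h. F \<beta> h > 0}"
  have bdd: "bdd_below S"
  proof (rule bdd_belowI)
    fix h assume "h \<in> S"
    then show "- \<bar>\<beta>\<bar> \<le> h"
      using free_energy_nonpos[of h \<beta>] by (cases "h \<le> - \<bar>\<beta>\<bar>") (auto simp: S_def)
  qed
  have ne: "S \<noteq> {}" using free_energy_pos_large_field[of \<beta> "\<bar>\<beta>\<bar> + 1"] by (auto simp: S_def)
  have ex: "F \<beta> h > 0 \<longleftrightarrow> h > Inf S" for h
  proof
    assume pos: "F \<beta> h > 0"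
    have "F \<beta> h \<le> F \<beta> (h - F \<beta> h / 2) + F \<beta> h / 2"
      using free_energy_lipschitz[of "h - F \<beta> h / 2" h \<beta>] pos by simp
    then have "h - F \<beta> h / 2 \<in> S" using pos by (simp add: S_def)
    then have "Inf S \<le> h - F \<beta> h / 2" by (intro cInf_lower bdd)
    then show "h > Inf S" using pos by linarith
  next
    assume "h > Inf S"
    then obtain h' where "h' \<in> S" "h' < h" using cInf_less_iff[OF ne bdd] by blast
    then show "F \<beta> h > 0" using free_energy_mono[of h' h \<beta>] by (simp add: S_def)
  qed
  have "quenched_critical_point M \<tau> Q \<omega> \<beta> = Inf S"
    unfolding quenched_critical_point_def
  proof (rule the_equality)
    fix hc assume "\<forall>h. F \<beta> h > 0 \<longleftrightarrow> h > hc"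
    then have "h > Inf S \<longleftrightarrow> h > hc" for h using ex by blast
    from this[of hc] this[of "Inf S"] show "hc = Inf S" by auto
  qed (use ex in blast)
  then show ?thesis using ex by simp
qed

section \<open>Infinite disorder\<close>

lemma free_energy_ge_log_entry:
  assumes "D > 0" "m \<ge> 1"
  shows "- (s / D) + (\<integral>w. log_entry \<beta> h (c0 * D powr (- s) * exp (- (s / D) * real m)) m w \<partial>law) / real (n0 + m) \<le> F \<beta> h"
    (is "?x \<le> _")
proof -
  have low: "AE y in Q. \<forall>e>0. \<forall>\<^sub>F N in sequentially. ?x - e \<le> ln (free (potential \<beta> h (env_path y)) N) / real N"
    using assms s_pos c0 by (intro growth_rate_lower kernel_exp_ge) auto
  obtain y where y: "\<forall>e>0. \<forall>\<^sub>F N in sequentially. ?x - e \<le> ln (free (potential \<beta> h (env_path y)) N) / real N"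
    and l: "(\<lambda>N. ln (free (potential \<beta> h (env_path y)) N) / real N) \<longlonglongrightarrow> F \<beta> h"
    using AE_Q_ex[OF AE_conjI[OF low free_energy_limit[of \<beta> h]]] by (elim bexE conjE)
  have "?x - e \<le> F \<beta> h" if "e > 0" for e
    using y that by (intro tendsto_lowerbound[OF l]) simp_all
  then have "?x \<le> F \<beta> h + e" if "e > 0" for e
    using that by (simp only: diff_le_eq)
  then show ?thesis by (rule field_le_epsilon)
qed

definition run :: "nat \<Rightarrow> (nat \<Rightarrow> real) set" where
  "run m = {w \<in> space law. \<forall>i\<in>{1..m}. w i = 1}"

lemma run_sets [measurable]: "run m \<in> sets law"
  unfolding run_def by measurable

lemma prob_run: "measure law (run m) = measure Q {y \<in> space Q. \<forall>i\<in>{1..m}. \<omega> i y = 1}"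
proof -
  have "measure law (run m) = measure Q (env_path -` run m \<inter> space Q)"
    using run_sets[of m] unfolding law_eq by (intro measure_distr omega_path_measurable) (simp add: law_eq)
  also have "env_path -` run m \<inter> space Q = {y \<in> space Q. \<forall>i\<in>{1..m}. \<omega> i y = 1}"
    by (auto simp: run_def path_in_space)
  finally show ?thesis .
qed

text \<open>
  On \<open>run m\<close> the window can be entered at its first site, after which the remaining \<open>m - 1\<close> sites
  carry the reward \<open>d\<close> each; off \<open>run m\<close> the window is skipped.
\<close>

lemma integral_log_entry_ge_run:
  assumes "c > 0" "h + \<beta> = d" "d > 0" "m \<ge> 1" and G: "0 < G" "G \<le> free (\<lambda>_. d) (m - 1)"
  shows "measure law (run m) * ln (c * G) \<le> (\<integral>w. log_entry \<beta> h c m w \<partial>law)"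
proof -
  have "measure law (run m) * ln (c * G) = (\<integral>w. indicator (run m) w * ln (c * G) \<partial>law)"
    by simp
  also have "\<dots> \<le> (\<integral>w. log_entry \<beta> h c m w \<partial>law)"
  proof (intro integral_mono log_entry_integrable)
    fix w
    show "indicator (run m) w * ln (c * G) \<le> log_entry \<beta> h c m w"
    proof (cases "w \<in> run m")
      case True
      have "G \<le> entry_sum (potential \<beta> h w) m"
        using free_le_entry_sum[of d m "potential \<beta> h w"] G assms True by (auto simp: run_def potential_def)
      then have "c * G \<le> 1 + c * entry_sum (potential \<beta> h w) m"
        using \<open>c > 0\<close> by (simp add: add_increasing)
      then have "ln (c * G) \<le> ln (1 + c * entry_sum (potential \<beta> h w) m)"
        using \<open>c > 0\<close> G by (intro ln_mono) auto
      then show ?thesis using True by (simp add: log_entry_def)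
    next
      case False
      then show ?thesis using \<open>c > 0\<close> by (simp add: log_entry_nonneg)
    qed
  next
    show "integrable law (\<lambda>w. indicator (run m) w * ln (c * G))"
      by (intro integrable_mult_left integrable_real_indicator run_sets) (simp add: env.emeasure_eq_measure)
  qed (use \<open>c > 0\<close> in simp)
  finally show ?thesis .
qed

lemma infinite_disorder_frequently:
  assumes "infinite_disorder Q \<omega>" "\<epsilon> > 0"
  shows "\<exists>\<^sub>F m in sequentially. m \<ge> 1 \<and> measure law (run m) > 0 \<and> - ln (measure law (run m)) \<le> \<epsilon> * real m"
proof (rule ccontr)
  let ?p = "\<lambda>m. measure law (run m)"
  assume "\<not> ?thesis"
  then have "\<forall>\<^sub>F m in sequentially. \<not> (m \<ge> 1 \<and> ?p m > 0 \<and> - ln (?p m) \<le> \<epsilon> * real m)"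
    by (simp add: not_frequently)
  then have "\<forall>\<^sub>F m in sequentially. ereal \<epsilon> \<le> ereal (1 / real m) * neg_log (?p m)"
    using eventually_ge_at_top[of 1]
  proof eventually_elim
    case (elim m)
    show ?case
    proof (cases "?p m = 0")
      case True
      then show ?thesis using elim by (simp add: neg_log_def)
    next
      case False
      then have "?p m > 0" using measure_nonneg[of law "run m"] by linarith
      then have "\<epsilon> * real m \<le> - ln (?p m)" using elim by auto
      then have "\<epsilon> \<le> 1 / real m * - ln (?p m)" using elim by (simp add: field_simps)
      then show ?thesis using False by (simp add: neg_log_def)
    qed
  qed
  then have "ereal \<epsilon> \<le> liminf (\<lambda>m. ereal (1 / real m) * neg_log (?p m))" by (rule Liminf_bounded)
  then show False using assms by (simp add: infinite_disorder_def prob_run)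
qed

text \<open>
  In \<open>free_energy_ge_log_entry\<close> with \<open>D = A / p\<close>, the linear cost is \<open>s / D = p s / A\<close> per site, while
  the windows contribute \<open>p\<close> times a gain that exceeds \<open>\<kappa> / 8\<close> per site of the window. The
  prefactor \<open>D powr (- s)\<close> costs \<open>s log (1 / p) \<le> \<kappa> m / 8\<close> by the choice of \<open>m\<close>, and the discount over the
  window costs \<open>m s / D \<le> \<kappa> m / 8\<close> by the choice of \<open>A\<close>; this leaves \<open>3 / 4\<close> of the gain \<open>\<kappa> m\<close>.
\<close>

theorem free_energy_pos_of_infinite_disorder:
  assumes "infinite_disorder Q \<omega>" and "h > - \<beta>"
  shows "F \<beta> h > 0"
proof -
  define d where "d = h + \<beta>"
  have d: "d > 0" using assms by (simp add: d_def)
  then obtain L r where L: "L > 0" "r > 1" and growth: "\<And>j. r ^ j \<le> free (\<lambda>_. d) (j * L)"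
    using free_homogeneous_growth[of d] by metis
  define \<kappa> where "\<kappa> = ln r / real L"
  have \<kappa>: "\<kappa> > 0" using L by (simp add: \<kappa>_def)
  define A where "A = max 1 (8 * s / \<kappa>)"
  have A: "A \<ge> 1" "s / A \<le> \<kappa> / 8" using \<kappa> s_pos by (auto simp: A_def max_def field_simps)
  define C where "C = ln c0 - s * ln A - \<kappa> * real L"
  have "(\<lambda>m. (C + 3 / 4 * \<kappa> * real m) / real (n0 + m)) \<longlonglongrightarrow> 3 / 4 * \<kappa>" by real_asymp
  moreover have "\<kappa> / 8 < 3 / 4 * \<kappa>" using \<kappa> by simp
  ultimately have "\<forall>\<^sub>F m in sequentially. \<kappa> / 8 < (C + 3 / 4 * \<kappa> * real m) / real (n0 + m)"
    by (rule order_tendstoD)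
  moreover have "\<exists>\<^sub>F m in sequentially. m \<ge> 1 \<and> measure law (run m) > 0 \<and>
      - ln (measure law (run m)) \<le> \<kappa> / (8 * s) * real m"
    using \<kappa> s_pos by (intro infinite_disorder_frequently assms(1)) simp
  ultimately have "\<exists>\<^sub>F m in sequentially. \<kappa> / 8 < (C + 3 / 4 * \<kappa> * real m) / real (n0 + m) \<and>
      m \<ge> 1 \<and> measure law (run m) > 0 \<and> - ln (measure law (run m)) \<le> \<kappa> / (8 * s) * real m"
    by (rule frequently_eventually_conj[rotated])
  from frequently_ex[OF this] obtain m where m: "m \<ge> 1" "measure law (run m) > 0"
      "- ln (measure law (run m)) \<le> \<kappa> / (8 * s) * real m"
      "\<kappa> / 8 < (C + 3 / 4 * \<kappa> * real m) / real (n0 + m)"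
    by (elim exE conjE)
  define p where "p = measure law (run m)"
  have p: "0 < p" "p \<le> 1" "- (s * ln p) \<le> \<kappa> / 8 * real m"
  proof -
    show "0 < p" "p \<le> 1" using m(2) env.prob_le_1 by (simp_all add: p_def)
    have "s * - ln p \<le> s * (\<kappa> / (8 * s) * real m)"
      using m(3) s_pos unfolding p_def by (intro mult_left_mono) auto
    then show "- (s * ln p) \<le> \<kappa> / 8 * real m" using s_pos by simp
  qed
  define D where "D = A / p"
  have D: "D > 0" "s / D = s / A * p" using A p by (auto simp: D_def)
  define c where "c = c0 * D powr (- s) * exp (- (s / D) * real m)"
  have c_pos: "c > 0" using c0 D by (simp add: c_def)
  define j where "j = (m - 1) div L"
  have "r ^ j \<le> free (\<lambda>_. d) (m - 1)"
    using growth[of j] free_homogeneous_mono[of d "j * L" "m - 1"] d by (simp add: j_def)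
  then have "p * ln (c * r ^ j) \<le> (\<integral>w. log_entry \<beta> h c m w \<partial>law)"
    unfolding p_def using c_pos d m(1) L by (intro integral_log_entry_ge_run[where d=d]) (auto simp: d_def)
  moreover have "C + 3 / 4 * \<kappa> * real m \<le> ln (c * r ^ j)"
  proof -
    have "m \<le> j * L + L"
      using div_mult_mod_eq[of "m - 1" L] mod_less_divisor[of L "m - 1"] L m(1) unfolding j_def by linarith
    then have "real m \<le> real j * real L + real L" by (metis of_nat_add of_nat_le_iff of_nat_mult)
    then have "\<kappa> * real m \<le> \<kappa> * (real j * real L + real L)" using \<kappa> by (intro mult_left_mono) auto
    moreover have "\<kappa> * real L = ln r" using L by (simp add: \<kappa>_def)
    moreover have "\<kappa> * (real j * real L + real L) = real j * (\<kappa> * real L) + \<kappa> * real L"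
      by (simp add: algebra_simps)
    ultimately have 1: "\<kappa> * real m - \<kappa> * real L \<le> real j * ln r" by simp
    have "s / A * p \<le> s / A * 1" using p s_pos A(1) by (intro mult_left_mono) auto
    then have "s / D \<le> \<kappa> / 8" using A(2) D(2) by linarith
    then have 2: "s / D * real m \<le> \<kappa> / 8 * real m" by (intro mult_right_mono) auto
    have "ln (c * r ^ j) = ln c0 - s * ln D - s / D * real m + real j * ln r"
      unfolding c_def using c0 D L by (simp add: ln_mult ln_powr ln_realpow)
    also have "ln D = ln A - ln p" using A p by (simp add: D_def ln_div)
    finally have "ln (c * r ^ j) = ln c0 - s * ln A + s * ln p - s / D * real m + real j * ln r"
      by (simp add: right_diff_distrib)
    then show ?thesis using 1 2 p(3) unfolding C_def by linarith
  qed
  then have "p * (C + 3 / 4 * \<kappa> * real m) \<le> p * ln (c * r ^ j)" using p by (intro mult_left_mono) auto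
  ultimately have "p * (C + 3 / 4 * \<kappa> * real m) / real (n0 + m) \<le> (\<integral>w. log_entry \<beta> h c m w \<partial>law) / real (n0 + m)"
    by (intro divide_right_mono) auto
  moreover have "p * (\<kappa> / 8) < p * ((C + 3 / 4 * \<kappa> * real m) / real (n0 + m))"
    using m(4) p by (intro mult_strict_left_mono) auto
  moreover have "s / D \<le> p * (\<kappa> / 8)"
    using mult_right_mono[OF A(2), of p] p D(2) by (simp add: mult.commute)
  moreover have "- (s / D) + (\<integral>w. log_entry \<beta> h c m w \<partial>law) / real (n0 + m) \<le> F \<beta> h"
    unfolding c_def using D m(1) by (intro free_energy_ge_log_entry) auto
  ultimately show ?thesis unfolding times_divide_eq_right by linarith
qed

corollary critical_point_of_infinite_disorder:
  assumes "infinite_disorder Q \<omega>" "\<beta> > 0"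
  shows "quenched_critical_point M \<tau> Q \<omega> \<beta> = - \<beta>"
proof -
  have "h > quenched_critical_point M \<tau> Q \<omega> \<beta> \<longleftrightarrow> h > - \<beta>" for h
    using free_energy_pos_of_infinite_disorder[OF assms(1), of \<beta> h] free_energy_nonpos[of h \<beta>] assms(2)
    unfolding critical_point_iff[symmetric] by (cases "h > - \<beta>") auto
  from this[of "- \<beta>"] this[of "quenched_critical_point M \<tau> Q \<omega> \<beta>"] show ?thesis by auto
qed

end

section \<open>Exponentially rare favourable sites\<close>

text \<open>
  The hypothesis on rare favourable sites speaks of increasing tuples of indices; this transports it
  to finite sets.
\<close>

lemma strict_mono_on_enumeration:
  fixes S :: "nat set"
  assumes "finite S"
  obtains i :: "nat \<Rightarrow> nat" where "strict_mono_on {1..card S} i" "i ` {1..card S} = S"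
proof -
  define xs where "xs = sorted_list_of_set S"
  have xs: "set xs = S" "sorted_wrt (<) xs" "length xs = card S"
    using assms by (simp_all add: xs_def strict_sorted_list_of_set)
  define i where "i k = xs ! (k - 1)" for k
  have "strict_mono_on {1..card S} i"
  proof (rule strict_mono_onI)
    fix r s assume "r \<in> {1..card S}" "s \<in> {1..card S}" "r < s"
    then show "i r < i s"
      unfolding i_def using xs by (intro sorted_wrt_nth_less[OF xs(2)]) auto
  qed
  moreover have "i ` {1..card S} = S"
  proof -
    have "i ` {1..card S} = (\<lambda>k. xs ! k) ` {..<length xs}"
    proof (intro equalityI subsetI)
      fix z assume "z \<in> i ` {1..card S}"
      then obtain k where "k \<in> {1..card S}" "z = xs ! (k - 1)" by (auto simp: i_def)
      then show "z \<in> (\<lambda>k. xs ! k) ` {..<length xs}" using xs(3) by (intro image_eqI[of _ _ "k - 1"]) auto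
    next
      fix z assume "z \<in> (\<lambda>k. xs ! k) ` {..<length xs}"
      then obtain k where "k < length xs" "z = xs ! k" by auto
      then show "z \<in> i ` {1..card S}" using xs(3) by (intro image_eqI[of _ _ "Suc k"]) (auto simp: i_def)
    qed
    also have "\<dots> = S" using xs(1) by (auto simp: set_conv_nth)
    finally show ?thesis .
  qed
  ultimately show thesis by (rule that)
qed

context pinning_model
begin

lemma omega_borel [measurable]: "\<omega> i \<in> borel_measurable Q"
  by (rule measurable_compose[OF omega_measurable]) auto

text \<open>
  Expanding the product over \<open>S\<close> expresses its expectation through the probabilities that all sites of
  a subset are favourable. Replacing them by \<open>exp(- c) ^ card X\<close> gives an expression that factorises
  again, as if the favourable sites were independent with probability \<open>exp(- c)\<close>.
\<close>

lemma expectation_prod_le: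
  assumes plus: "\<And>X. finite X \<Longrightarrow> X \<subseteq> {1..} \<Longrightarrow> measure Q {y \<in> space Q. \<forall>n\<in>X. \<omega> n y = 1} \<le> exp (- c) ^ card X"
    and S: "finite S" "S \<subseteq> {1..}" and q: "0 \<le> q" "q \<le> 1"
  shows "(\<integral>y. (\<Prod>n\<in>S. (1 - q) * of_bool (\<omega> n y = 1) + q) \<partial>Q) \<le> ((1 - q) * exp (- c) + q) ^ card S"
proof -
  interpret Q: prob_space Q by (rule prob_space_Q)
  define R where "R X = {y \<in> space Q. \<forall>n\<in>X. \<omega> n y = 1}" for X
  have R: "R X \<in> sets Q" if "finite X" for X
    unfolding R_def using that by measurable
  have "(\<Prod>n\<in>S. (1 - q) * of_bool (\<omega> n y = 1) + q) =
      (\<Sum>X\<in>Pow S. indicator (R X) y * ((1 - q) ^ card X * q ^ card (S - X)))" if y: "y \<in> space Q" for y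
  proof -
    have "(\<Prod>n\<in>X. (1 - q) * of_bool (\<omega> n y = 1)) = indicator (R X) y * (1 - q) ^ card X" if "X \<in> Pow S" for X
    proof -
      have "finite X" using that S finite_subset by blast
      then show ?thesis using y
        by (cases "\<forall>n\<in>X. \<omega> n y = 1") (auto simp: R_def prod.distrib prod_zero_iff)
    qed
    then show ?thesis
      by (subst prod_add[OF S(1)]) (auto intro!: sum.cong)
  qed
  then have "(\<integral>y. (\<Prod>n\<in>S. (1 - q) * of_bool (\<omega> n y = 1) + q) \<partial>Q) =
      (\<integral>y. (\<Sum>X\<in>Pow S. indicator (R X) y * ((1 - q) ^ card X * q ^ card (S - X))) \<partial>Q)"
    by (intro Bochner_Integration.integral_cong) auto
  also have "\<dots> = (\<Sum>X\<in>Pow S. measure Q (R X) * ((1 - q) ^ card X * q ^ card (S - X)))"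
  proof (subst Bochner_Integration.integral_sum)
    fix X assume "X \<in> Pow S"
    then have "R X \<in> sets Q" using S finite_subset R by blast
    then show "integrable Q (\<lambda>y. indicator (R X) y * ((1 - q) ^ card X * q ^ card (S - X)))"
      by (intro integrable_mult_left integrable_real_indicator) (simp_all add: Q.emeasure_eq_measure)
  next
    show "(\<Sum>X\<in>Pow S. \<integral>y. indicator (R X) y * ((1 - q) ^ card X * q ^ card (S - X)) \<partial>Q) =
        (\<Sum>X\<in>Pow S. measure Q (R X) * ((1 - q) ^ card X * q ^ card (S - X)))"
    proof (intro sum.cong refl)
      fix X assume "X \<in> Pow S"
      have "R X \<inter> space Q = R X" by (auto simp: R_def)
      then show "(\<integral>y. indicator (R X) y * ((1 - q) ^ card X * q ^ card (S - X)) \<partial>Q) =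
          measure Q (R X) * ((1 - q) ^ card X * q ^ card (S - X))"
        by simp
    qed
  qed
  also have "\<dots> \<le> (\<Sum>X\<in>Pow S. exp (- c) ^ card X * ((1 - q) ^ card X * q ^ card (S - X)))"
  proof (intro sum_mono mult_right_mono)
    fix X assume "X \<in> Pow S"
    then show "measure Q (R X) \<le> exp (- c) ^ card X"
      unfolding R_def using S finite_subset by (intro plus) blast+
  qed (use q in simp)
  also have "\<dots> = (\<Sum>X\<in>Pow S. (\<Prod>n\<in>X. (1 - q) * exp (- c)) * (\<Prod>n\<in>S - X. q))"
    by (simp add: power_mult_distrib mult_ac)
  also have "\<dots> = (\<Prod>n\<in>S. (1 - q) * exp (- c) + q)"
    by (rule prod_add[OF S(1), symmetric])
  also have "\<dots> = ((1 - q) * exp (- c) + q) ^ card S" by simp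
  finally show ?thesis .
qed

text \<open>
  The field is chosen so that \<open>(1 - q) exp(- c) + q = 1 - (h + \<beta>)\<close>, and \<open>1 - x \<le> exp(- x)\<close>.
\<close>

lemma annealed_weight_le_1:
  assumes plus: "\<And>X. finite X \<Longrightarrow> X \<subseteq> {1..} \<Longrightarrow> measure Q {y \<in> space Q. \<forall>n\<in>X. \<omega> n y = 1} \<le> exp (- c) ^ card X"
    and S: "finite S" "S \<subseteq> {1..}" and "\<beta> \<ge> 0"
    and h: "h + \<beta> = (1 - exp (- 2 * \<beta>)) * (1 - exp (- c))"
  shows "(\<integral>y. exp (\<Sum>n\<in>S. h + \<beta> * \<omega> n y) \<partial>Q) \<le> 1"
proof -
  define q where "q = exp (- 2 * \<beta>)"
  have q: "0 \<le> q" "q \<le> 1" using \<open>\<beta> \<ge> 0\<close> by (simp_all add: q_def)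
  have weight: "exp (h + \<beta> * \<omega> n y) = exp (h + \<beta>) * ((1 - q) * of_bool (\<omega> n y = 1) + q)" if "y \<in> space Q" for n y
    using omega_values[OF that, of n] by (auto simp: q_def simp flip: exp_add)
  have "(\<integral>y. exp (\<Sum>n\<in>S. h + \<beta> * \<omega> n y) \<partial>Q)
      = (\<integral>y. exp (h + \<beta>) ^ card S * (\<Prod>n\<in>S. (1 - q) * of_bool (\<omega> n y = 1) + q) \<partial>Q)"
    by (intro Bochner_Integration.integral_cong refl) (simp add: exp_sum S(1) weight prod.distrib)
  also have "\<dots> \<le> exp (h + \<beta>) ^ card S * ((1 - q) * exp (- c) + q) ^ card S"
    using expectation_prod_le[OF plus S q] by simp
  also have "\<dots> = (exp (h + \<beta>) * ((1 - q) * exp (- c) + q)) ^ card S" by (simp add: power_mult_distrib)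
  also have "\<dots> \<le> 1"
  proof (rule power_le_one)
    have "(1 - q) * exp (- c) + q = 1 - (h + \<beta>)" unfolding h q_def by (simp add: algebra_simps)
    also have "\<dots> \<le> exp (- (h + \<beta>))" using exp_ge_add_one_self[of "- (h + \<beta>)"] by (simp only: diff_conv_add_uminus)
    finally have "exp (h + \<beta>) * ((1 - q) * exp (- c) + q) \<le> exp (h + \<beta>) * exp (- (h + \<beta>))"
      by (intro mult_left_mono) auto
    then show "exp (h + \<beta>) * ((1 - q) * exp (- c) + q) \<le> 1" by (simp flip: exp_add)
    show "0 \<le> exp (h + \<beta>) * ((1 - q) * exp (- c) + q)" using q by simp
  qed
  finally show ?thesis .
qed

lemma renewal_indicator_measurable [measurable]: "renewal_indicator \<tau> n \<in> borel_measurable M"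
proof -
  have "renewal_indicator \<tau> n = (\<lambda>x. of_bool (\<exists>i. \<tau> i x = n))"
    by (auto simp: renewal_indicator_def fun_eq_iff)
  then show ?thesis by simp
qed

lemma annealed_partition_function_le_1:
  assumes plus: "\<And>X. finite X \<Longrightarrow> X \<subseteq> {1..} \<Longrightarrow> measure Q {y \<in> space Q. \<forall>n\<in>X. \<omega> n y = 1} \<le> exp (- c) ^ card X"
    and "\<beta> \<ge> 0" and h: "h + \<beta> = (1 - exp (- 2 * \<beta>)) * (1 - exp (- c))"
  shows "(\<integral>y. pinning_partition_function M \<tau> (\<lambda>i. \<omega> i y) \<beta> h N \<partial>Q) \<le> 1"
proof -
  interpret Q: prob_space Q by (rule prob_space_Q)
  interpret MQ: pair_prob_space M Q ..
  let ?f = "\<lambda>x y. exp (\<Sum>n=1..N. (h + \<beta> * \<omega> n y) * renewal_indicator \<tau> n x)"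
  let ?S = "\<lambda>x. {1..N} \<inter> range (\<lambda>i. \<tau> i x)"
  have sum_eq: "(\<Sum>n=1..N. (h + \<beta> * \<omega> n y) * renewal_indicator \<tau> n x) = (\<Sum>n\<in>?S x. h + \<beta> * \<omega> n y)" for x y
    by (subst sum.inter_restrict, simp, intro sum.cong refl) (simp add: renewal_indicator_def)
  have bound: "\<bar>?f x y\<bar> \<le> exp (real N * (\<bar>h\<bar> + \<bar>\<beta>\<bar>))" if "y \<in> space Q" for x y
  proof -
    have "(\<Sum>n=1..N. (h + \<beta> * \<omega> n y) * renewal_indicator \<tau> n x) \<le> (\<Sum>n=1..N. \<bar>h\<bar> + \<bar>\<beta>\<bar>)"
    proof (rule sum_mono)
      fix n
      show "(h + \<beta> * \<omega> n y) * renewal_indicator \<tau> n x \<le> \<bar>h\<bar> + \<bar>\<beta>\<bar>"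
        using omega_values[OF that, of n] by (auto simp: renewal_indicator_def of_bool_def)
    qed
    then show ?thesis by simp
  qed
  have "integrable (M \<Otimes>\<^sub>M Q) (case_prod ?f)"
  proof (rule MQ.integrable_const_bound[where B="exp (real N * (\<bar>h\<bar> + \<bar>\<beta>\<bar>))"])
    show "AE z in M \<Otimes>\<^sub>M Q. norm (case_prod ?f z) \<le> exp (real N * (\<bar>h\<bar> + \<bar>\<beta>\<bar>))"
      using bound by (intro AE_I2) (auto simp: space_pair_measure)
  qed measurable
  then have "(\<integral>y. pinning_partition_function M \<tau> (\<lambda>i. \<omega> i y) \<beta> h N \<partial>Q) = (\<integral>x. (\<integral>y. ?f x y \<partial>Q) \<partial>M)"
    unfolding pinning_partition_function_def by (rule MQ.Fubini_integral)
  also have "\<dots> \<le> (\<integral>x. 1 \<partial>M)"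
  proof (rule integral_mono')
    fix x
    show "(\<integral>y. ?f x y \<partial>Q) \<le> 1"
      unfolding sum_eq by (rule annealed_weight_le_1[OF plus _ _ \<open>\<beta> \<ge> 0\<close> h]) auto
  qed simp_all
  finally show ?thesis by (simp add: prob_space)
qed

end

context polynomial_pinning_model
begin

text \<open>
  By \<open>log Z \<le> Z - 1\<close> the expectation of \<open>log Z\<^sub>N\<close> is at most \<open>0\<close>, and the expectations of the bounded
  variables \<open>(1 / N) log Z\<^sub>N\<close> converge to the free energy.
\<close>

lemma free_energy_nonpos_of_annealed:
  assumes "\<And>N. (\<integral>y. pinning_partition_function M \<tau> (env_path y) \<beta> h N \<partial>Q) \<le> 1"
  shows "F \<beta> h \<le> 0"
proof -
  interpret Q: prob_space Q by (rule prob_space_Q)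
  let ?Z = "\<lambda>N y. free (potential \<beta> h (env_path y)) N"
  let ?C = "\<bar>h\<bar> + \<bar>\<beta>\<bar>"
  have bound: "\<bar>potential \<beta> h (env_path y) n\<bar> \<le> ?C" if "y \<in> space Q" for y n
    by (rule potential_bound[OF path_in_space[OF that]])
  have Z_le: "?Z N y \<le> exp (?C * real N)" if "y \<in> space Q" for y N
    by (rule free_le_exp) (rule bound[OF that])
  have ln_Z: "\<bar>ln (?Z N y)\<bar> \<le> ?C * real N" if "y \<in> space Q" for y N
    by (rule abs_ln_free_le) (rule bound[OF that])
  have Z_eq: "pinning_partition_function M \<tau> (env_path y) \<beta> h N = ?Z N y" if "y \<in> space Q" for y N
    using partition_function_eq_free[of h \<beta> "env_path y" ?C N] bound[OF that]
    by (simp add: potential_def[abs_def])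
  have "(\<lambda>w. free (potential \<beta> h w) N) \<in> borel_measurable law" for N
    by (rule free_measurable) (simp add: potential_def)
  then have Z[measurable]: "?Z N \<in> borel_measurable Q" for N
    using measurable_compose[OF omega_path_measurable] unfolding measurable_law by blast
  have Z_int: "integrable Q (?Z N)" for N
  proof (rule Q.integrable_const_bound[where B="exp (?C * real N)"])
    show "AE y in Q. norm (?Z N y) \<le> exp (?C * real N)"
      using Z_le free_nonneg by (intro AE_I2) simp
  qed simp
  have ln_int: "integrable Q (\<lambda>y. ln (?Z N y))" for N
  proof (rule Q.integrable_const_bound[where B="?C * real N"])
    show "AE y in Q. norm (ln (?Z N y)) \<le> ?C * real N"
      using ln_Z by (intro AE_I2) simp
  qed simp
  have nonpos: "(\<integral>y. ln (?Z N y) / real N \<partial>Q) \<le> 0" for N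
  proof -
    have "(\<integral>y. ln (?Z N y) \<partial>Q) \<le> (\<integral>y. ?Z N y - 1 \<partial>Q)"
      using ln_le_minus_one[OF free_pos] by (intro integral_mono ln_int) (auto intro: Z_int)
    also have "\<dots> = (\<integral>y. ?Z N y \<partial>Q) - 1" using Z_int by (simp add: Q.prob_space)
    also have "(\<integral>y. ?Z N y \<partial>Q) = (\<integral>y. pinning_partition_function M \<tau> (env_path y) \<beta> h N \<partial>Q)"
      by (intro Bochner_Integration.integral_cong refl) (simp add: Z_eq)
    finally have "(\<integral>y. ln (?Z N y) \<partial>Q) \<le> 0" using assms[of N] by linarith
    then show ?thesis by (simp add: divide_nonpos_nonneg)
  qed
  have "(\<lambda>N. \<integral>y. ln (?Z N y) / real N \<partial>Q) \<longlonglongrightarrow> (\<integral>y. F \<beta> h \<partial>Q)"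
  proof (rule integral_dominated_convergence[where w="\<lambda>_. ?C"])
    show "AE y in Q. norm (ln (?Z N y) / real N) \<le> ?C" for N
    proof (rule AE_I2)
      fix y assume "y \<in> space Q"
      then have "\<bar>ln (?Z N y)\<bar> \<le> ?C * real N" by (rule ln_Z)
      then show "norm (ln (?Z N y) / real N) \<le> ?C" by (cases "N = 0") (simp_all add: pos_divide_le_eq)
    qed
  qed (use free_energy_limit[of \<beta> h] in simp_all)
  then have "(\<lambda>N. \<integral>y. ln (?Z N y) / real N \<partial>Q) \<longlonglongrightarrow> F \<beta> h" by (simp add: Q.prob_space)
  then show ?thesis using nonpos by (intro LIMSEQ_le_const2) auto
qed

theorem critical_point_ge:
  assumes plus: "\<And>X. finite X \<Longrightarrow> X \<subseteq> {1..} \<Longrightarrow> measure Q {y \<in> space Q. \<forall>n\<in>X. \<omega> n y = 1} \<le> exp (- c) ^ card X"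
    and "\<beta> \<ge> 0"
  shows "- \<beta> + (1 - exp (- 2 * \<beta>)) * (1 - exp (- c)) \<le> quenched_critical_point M \<tau> Q \<omega> \<beta>"
proof -
  have "F \<beta> (- \<beta> + (1 - exp (- 2 * \<beta>)) * (1 - exp (- c))) \<le> 0"
    by (intro free_energy_nonpos_of_annealed annealed_partition_function_le_1[OF plus \<open>\<beta> \<ge> 0\<close>]) simp_all
  then show ?thesis using critical_point_iff[of \<beta>] by (simp add: not_less[symmetric])
qed

end

section \<open>The critical point in the two regimes\<close>

theorem theorem2p4:
  fixes M :: "'a measure" and \<tau> :: "nat \<Rightarrow> 'a \<Rightarrow> nat"
    and Q :: "'b measure" and \<omega> :: "nat \<Rightarrow> 'b \<Rightarrow> real"
    and \<alpha> c\<^sub>K :: real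
  assumes "recurrent_renewal_process M \<tau>"
    and "\<alpha> > 0" and "\<alpha> \<noteq> 1" and "c\<^sub>K > 0"
    and "renewal_kernel M \<tau> \<sim>[at_top] (\<lambda>n. c\<^sub>K * real n powr (- (1 + \<alpha>)))"
    and "pinning_environment Q \<omega>"
  shows "(infinite_disorder Q \<omega> \<longrightarrow>
            (\<forall>\<beta>>0. quenched_critical_point M \<tau> Q \<omega> \<beta> = - \<beta>)) \<and>
         ((\<exists>c>0. \<forall>n\<ge>1. \<forall>i :: nat \<Rightarrow> nat. 1 \<le> i 1 \<and> strict_mono_on {1..n} i \<longrightarrow>
              measure Q {y \<in> space Q. \<forall>k\<in>{1..n}. \<omega> (i k) y = 1} \<le> exp (- c * real n)) \<longrightarrow>
            (\<exists>c\<^sub>\<beta> :: real \<Rightarrow> real.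
               (\<forall>\<beta>>0. c\<^sub>\<beta> \<beta> > 0) \<and>
               (\<exists>\<epsilon>>0. \<forall>\<beta>\<in>{0<..<1}. c\<^sub>\<beta> \<beta> \<ge> \<epsilon>) \<and>
               (\<forall>\<beta>>0. quenched_critical_point M \<tau> Q \<omega> \<beta> \<ge> - (1 - c\<^sub>\<beta> \<beta>) * \<beta> \<and>
                       - (1 - c\<^sub>\<beta> \<beta>) * \<beta> > - \<beta>)))"
proof -
  interpret pinning_model M \<tau> Q \<omega>
    by unfold_locales (rule assms)+
  \<comment> \<open>Capping the constant at \<open>1\<close> keeps it a lower bound and makes it usable as a discount.\<close>
  obtain n0 where n0: "n0 \<ge> 1"
    and K_ge: "\<And>n. n \<ge> n0 \<Longrightarrow> min 1 (c\<^sub>K / 2) * real n powr (- (1 + \<alpha>)) \<le> K n"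
  proof -
    let ?g = "\<lambda>n. c\<^sub>K * real n powr (- (1 + \<alpha>))"
    have "((\<lambda>n. K n / ?g n) \<longlongrightarrow> 1) at_top"
    proof (rule asymp_equivD_strong[OF assms(5)])
      show "\<forall>\<^sub>F n in at_top. K n \<noteq> 0 \<or> ?g n \<noteq> 0"
        using eventually_gt_at_top[of 0] by eventually_elim (use assms(4) in simp)
    qed
    then have "\<forall>\<^sub>F n in at_top. 1 / 2 < K n / ?g n" by (rule order_tendstoD) simp
    then obtain m where m: "\<And>n. n \<ge> m \<Longrightarrow> 1 / 2 < K n / ?g n" by (auto simp: eventually_at_top_linorder)
    have "min 1 (c\<^sub>K / 2) * real n powr (- (1 + \<alpha>)) \<le> K n" if "n \<ge> max 1 m" for n
    proof -
      have "?g n > 0" using that assms(4) by simp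
      moreover have "1 / 2 < K n / ?g n" using m that by simp
      ultimately have "1 / 2 * ?g n < K n" by (simp only: pos_less_divide_eq)
      moreover have "min 1 (c\<^sub>K / 2) * real n powr (- (1 + \<alpha>)) \<le> c\<^sub>K / 2 * real n powr (- (1 + \<alpha>))"
        by (intro mult_right_mono) auto
      ultimately show ?thesis by simp
    qed
    then show thesis by (intro that[of "max 1 m"]) auto
  qed
  interpret polynomial_pinning_model M \<tau> Q \<omega> "1 + \<alpha>" "min 1 (c\<^sub>K / 2)" n0
  proof
    show "1 + \<alpha> > 0" "0 < min 1 (c\<^sub>K / 2)" "min 1 (c\<^sub>K / 2) \<le> 1" using assms(2,4) by simp_all
    show "min 1 (c\<^sub>K / 2) * real n powr (- (1 + \<alpha>)) \<le> K n" if "n0 \<le> n" for n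
      using K_ge[OF that] .
    show "1 \<le> n0" by (rule n0)
  qed
  show ?thesis
  proof (intro conjI impI)
    assume "infinite_disorder Q \<omega>"
    then show "\<forall>\<beta>>0. quenched_critical_point M \<tau> Q \<omega> \<beta> = - \<beta>"
      using critical_point_of_infinite_disorder by blast
  next
    assume "\<exists>c>0. \<forall>n\<ge>1. \<forall>i :: nat \<Rightarrow> nat. 1 \<le> i 1 \<and> strict_mono_on {1..n} i \<longrightarrow>
              measure Q {y \<in> space Q. \<forall>k\<in>{1..n}. \<omega> (i k) y = 1} \<le> exp (- c * real n)"
    then obtain c where c: "c > 0" and rare: "\<And>n i. n \<ge> 1 \<Longrightarrow> 1 \<le> i 1 \<Longrightarrow> strict_mono_on {1..n} i \<Longrightarrow>
              measure Q {y \<in> space Q. \<forall>k\<in>{1..n}. \<omega> (i k) y = 1} \<le> exp (- c * real n)"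
      by blast
    have plus: "measure Q {y \<in> space Q. \<forall>n\<in>X. \<omega> n y = 1} \<le> exp (- c) ^ card X"
      if X: "finite X" "X \<subseteq> {1..}" for X
    proof (cases "X = {}")
      case True
      then show ?thesis using prob_space.prob_le_1[OF prob_space_Q] by simp
    next
      case False
      then have card: "card X \<ge> 1" using X by (simp add: Suc_le_eq card_gt_0_iff)
      obtain i where i: "strict_mono_on {1..card X} i" "i ` {1..card X} = X"
        using strict_mono_on_enumeration[OF X(1)] by blast
      have "i 1 \<in> X" using i(2) card by (metis atLeastAtMost_iff image_eqI order_refl)
      then have "1 \<le> i 1" using X by auto
      then have "measure Q {y \<in> space Q. \<forall>k\<in>{1..card X}. \<omega> (i k) y = 1} \<le> exp (- c * real (card X))"
        by (intro rare card i)
      moreover have "(\<forall>k\<in>{1..card X}. \<omega> (i k) y = 1) \<longleftrightarrow> (\<forall>n\<in>i ` {1..card X}. \<omega> n y = 1)" for y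
        by blast
      ultimately show ?thesis unfolding exp_of_nat2_mult i(2) by simp
    qed
    \<comment> \<open>The value for which \<open>- (1 - b \<beta>) * \<beta>\<close> is the bound of \<open>critical_point_ge\<close>.\<close>
    define b where "b \<beta> = (1 - exp (- 2 * \<beta>)) * (1 - exp (- c)) / \<beta>" for \<beta> :: real
    have b_pos: "b \<beta> > 0" if "\<beta> > 0" for \<beta>
      using that c by (simp add: b_def)
    have b_ge: "2 / 3 * (1 - exp (- c)) \<le> b \<beta>" if "\<beta> \<in> {0<..<1}" for \<beta>
    proof -
      have "1 + 2 * \<beta> \<le> exp (2 * \<beta>)" by (rule exp_ge_add_one_self)
      then have "exp (- 2 * \<beta>) \<le> 1 / (1 + 2 * \<beta>)"
        using that by (simp add: exp_minus field_simps)
      then have "2 * \<beta> / (1 + 2 * \<beta>) \<le> 1 - exp (- 2 * \<beta>)"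
        using that by (simp add: field_simps)
      moreover have "2 / 3 * \<beta> \<le> 2 * \<beta> / (1 + 2 * \<beta>)"
        using that by (simp add: field_simps)
      ultimately have "2 / 3 * \<beta> \<le> 1 - exp (- 2 * \<beta>)" by linarith
      then have "2 / 3 \<le> (1 - exp (- 2 * \<beta>)) / \<beta>" using that by (simp add: field_simps)
      then have "2 / 3 * (1 - exp (- c)) \<le> (1 - exp (- 2 * \<beta>)) / \<beta> * (1 - exp (- c))"
        using c by (intro mult_right_mono) auto
      then show ?thesis by (simp add: b_def)
    qed
    have b_eq: "- (1 - b \<beta>) * \<beta> = - \<beta> + (1 - exp (- 2 * \<beta>)) * (1 - exp (- c))" if "\<beta> > 0" for \<beta>
    proof -
      have "b \<beta> * \<beta> = (1 - exp (- 2 * \<beta>)) * (1 - exp (- c))" using that by (simp add: b_def)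
      moreover have "- (1 - b \<beta>) * \<beta> = - \<beta> + b \<beta> * \<beta>" by (simp add: algebra_simps)
      ultimately show ?thesis by simp
    qed
    show "\<exists>c\<^sub>\<beta> :: real \<Rightarrow> real.
               (\<forall>\<beta>>0. c\<^sub>\<beta> \<beta> > 0) \<and>
               (\<exists>\<epsilon>>0. \<forall>\<beta>\<in>{0<..<1}. c\<^sub>\<beta> \<beta> \<ge> \<epsilon>) \<and>
               (\<forall>\<beta>>0. quenched_critical_point M \<tau> Q \<omega> \<beta> \<ge> - (1 - c\<^sub>\<beta> \<beta>) * \<beta> \<and>
                       - (1 - c\<^sub>\<beta> \<beta>) * \<beta> > - \<beta>)"
    proof (intro exI[of _ b] conjI allI impI)
      show "\<exists>\<epsilon>>0. \<forall>\<beta>\<in>{0<..<1}. b \<beta> \<ge> \<epsilon>"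
        using b_ge c by (intro exI[of _ "2 / 3 * (1 - exp (- c))"]) auto
      fix \<beta> :: real assume \<beta>: "\<beta> > 0"
      show "b \<beta> > 0" by (rule b_pos[OF \<beta>])
      show "- (1 - b \<beta>) * \<beta> \<le> quenched_critical_point M \<tau> Q \<omega> \<beta>"
        unfolding b_eq[OF \<beta>] using \<beta> by (intro critical_point_ge plus) auto
      show "- \<beta> < - (1 - b \<beta>) * \<beta>"
        using b_pos[OF \<beta>] \<beta> by (simp add: left_diff_distrib)
    qed
  qed
qed

end
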